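(* Let $X(\cdot,\lambda)$ be the associated family of flat Lagrangian immersions in $\mathbb{C}^n$ with non-degenerate normal bundle for the flat Egoroff metric $\sum_{i=1}^nh_i(u)^2\,du_i^2$ on $\Omega$, and $F=\begin{pmatrix}E&X\\0&1\end{pmatrix}$ its extended frame; write $E_\lambda=E(\cdot,\lambda)$. Let $\alpha\in\mathbb{R}\setminus\{0\}$, $b\in\mathbb{R}^n$, and $k_{\mathrm{i}\alpha,b}(\lambda)=\begin{pmatrix}\mathrm{I}&\frac{\mathrm{i}b}{\lambda-\mathrm{i}\alpha}\\0&1\end{pmatrix}$. Then $$k_{\mathrm{i}\alpha,b}\ast X:=X+\frac{\mathrm{i}\,(b-E_\lambda E_{\mathrm{i}\alpha}^{-1}b)}{\lambda-\mathrm{i}\alpha}$$ is a family of flat Lagrangian immersions associated to the flat Egoroff metric $\sum_i\check h_i^2\,du_i^2$ given by $$\check h=k_{\mathrm{i}\alpha,b}\ast h=h+E_{\mathrm{i}\alpha}^{-1}b$$ (on any open set where all entries of $\check h$ are nonzero).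
   Context: $\Omega\subset\mathbb{R}^n$ is a connected, simply connected open neighbourhood of $0$ with coordinates $u$. $\delta=\mathrm{diag}(du_1,\dots,du_n)$, $[\delta,\beta]=\delta\beta-\beta\delta$. A flat Egoroff metric is a flat Riemannian metric $\sum_i h_i^2\,du_i^2$, with $h_i$ smooth, real-valued and nowhere zero, for which there is a function $\phi$ with $\partial\phi/\partial u_i=h_i^2$; $h=(h_1,\dots,h_n)^t$. Its rotation coefficient matrix is $\beta_{ij}=(h_i)_{u_j}/h_j$ for $i\ne j$, $\beta_{ii}=0$ (symmetric). Its extended frame is the unique $F(u,\lambda)=\begin{pmatrix}E&X\\0&1\end{pmatrix}$, holomorphic in $\lambda\in\mathbb{C}$, with $F^{-1}dF=\begin{pmatrix}\mathrm{i}\lambda\delta+[\delta,\beta]&\delta h\\0&0\end{pmatrix}$, $F(0,\lambda)=\mathrm{I}$. The associated family is $X(\cdot,\lambda)$, $\lambda\in\mathbb{R}\setminus\{0\}$: flat Lagrangian immersions into $\mathbb{C}^n=\mathbb{R}^{2n}$ with $\mathrm{I}=\sum_ih_i^2du_i^2$ and $\mathrm{II}_\lambda=\lambda\sum_i du_i^2\otimes J(\partial X/\partial u_i)$, $J$ being multiplication by $\mathrm{i}$. (An $n$-dimensional immersion in $\mathbb{C}^n$ is Lagrangian if $\mathrm{Im}(\bar Z_1^tZ_2)$ pulls back to $0$, flat if its induced metric is flat; its normal bundle is non-degenerate if the space of shape operators at each point has dimension equal to the codimension.) The notation $k_{\mathrm{i}\alpha,b}\ast$ refers to dressing: the factorization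 $k_{\mathrm{i}\alpha,b}F=\check F\check k$ with $\check F(u,\cdot)$ holomorphic on $\mathbb{C}$ and $\check k(u,\cdot)$ holomorphic near $\lambda=\infty$ with $\check k(u,\infty)=\mathrm{I}$; $k_{\mathrm{i}\alpha,b}\ast X$ and $k_{\mathrm{i}\alpha,b}\ast h$ are the $X$- and $h$-data of $\check F$. *)

theory Defs
  imports "HOL-Analysis.Analysis"
begin

primrec Ck_on :: "nat \<Rightarrow> 'a::real_normed_vector set \<Rightarrow> ('a \<Rightarrow> 'b::real_normed_vector) \<Rightarrow> bool" where
  "Ck_on 0 U f \<longleftrightarrow> continuous_on U f"
| "Ck_on (Suc k) U f \<longleftrightarrow>
     (\<forall>x\<in>U. f differentiable (at x)) \<and> (\<forall>v. Ck_on k U (\<lambda>x. frechet_derivative f (at x) v))"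

text \<open>To be used on open sets of finite-dimensional spaces.\<close>
definition smooth_on :: "'a::real_normed_vector set \<Rightarrow> ('a \<Rightarrow> 'b::real_normed_vector) \<Rightarrow> bool" where
  "smooth_on U f \<longleftrightarrow> (\<forall>k. Ck_on k U f)"

definition partial :: "'n::finite \<Rightarrow> (real^'n \<Rightarrow> 'b::real_normed_vector) \<Rightarrow> real^'n \<Rightarrow> 'b" where
  "partial i f u = frechet_derivative f (at u) (axis i 1)"

definition riemannian_metric_on :: "(real^'n) set \<Rightarrow> (real^'n \<Rightarrow> real^'n^'n) \<Rightarrow> bool" where
  "riemannian_metric_on U g \<longleftrightarrow> smooth_on U g \<and>
     (\<forall>u\<in>U. transpose (g u) = g u \<and> (\<forall>v. v \<noteq> 0 \<longrightarrow> v \<bullet> (g u *v v) > 0))"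

text \<open>\<open>christoffel g k i j\<close> is the Christoffel symbol with upper index \<open>k\<close>.\<close>
definition christoffel ::
  "(real^'n \<Rightarrow> real^'n^'n) \<Rightarrow> 'n \<Rightarrow> 'n \<Rightarrow> 'n \<Rightarrow> real^'n \<Rightarrow> real" where
  "christoffel g k i j u = (1/2) * (\<Sum>l\<in>UNIV. matrix_inv (g u) $ k $ l *
     (partial i (\<lambda>x. g x $ j $ l) u + partial j (\<lambda>x. g x $ i $ l) u - partial l (\<lambda>x. g x $ i $ j) u))"

text \<open>The \<open>\<partial>\<^sub>l\<close>-component of \<open>R(\<partial>\<^sub>i, \<partial>\<^sub>j) \<partial>\<^sub>k\<close>.\<close>
definition riemann_curvature ::
  "(real^'n \<Rightarrow> real^'n^'n) \<Rightarrow> 'n \<Rightarrow> 'n \<Rightarrow> 'n \<Rightarrow> 'n \<Rightarrow> real^'n \<Rightarrow> real" where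
  "riemann_curvature g l k i j u =
     partial i (christoffel g l j k) u - partial j (christoffel g l i k) u +
     (\<Sum>m\<in>UNIV. christoffel g l i m u * christoffel g m j k u
                - christoffel g l j m u * christoffel g m i k u)"

definition flat_metric_on :: "(real^'n) set \<Rightarrow> (real^'n \<Rightarrow> real^'n^'n) \<Rightarrow> bool" where
  "flat_metric_on U g \<longleftrightarrow> riemannian_metric_on U g \<and>
     (\<forall>u\<in>U. \<forall>l k i j. riemann_curvature g l k i j u = 0)"

definition diag_matrix :: "'a::zero^'n \<Rightarrow> 'a^'n^'n" where
  "diag_matrix v = (\<chi> i j. if i = j then v $ i else 0)"

definition diagonal_metric :: "(real^'n \<Rightarrow> real^'n) \<Rightarrow> real^'n \<Rightarrow> real^'n^'n" where
  "diagonal_metric h u = diag_matrix (\<chi> i. (h u $ i)\<^sup>2)"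

definition flat_egoroff_on :: "(real^'n) set \<Rightarrow> (real^'n \<Rightarrow> real^'n) \<Rightarrow> bool" where
  "flat_egoroff_on U h \<longleftrightarrow>
     smooth_on U h \<and> (\<forall>u\<in>U. \<forall>i. h u $ i \<noteq> 0) \<and> flat_metric_on U (diagonal_metric h) \<and>
     (\<exists>\<phi>::real^'n \<Rightarrow> real. \<forall>u\<in>U. \<phi> differentiable (at u) \<and> (\<forall>i. partial i \<phi> u = (h u $ i)\<^sup>2))"

definition rotation_coefficients :: "(real^'n \<Rightarrow> real^'n) \<Rightarrow> real^'n \<Rightarrow> real^'n^'n" where
  "rotation_coefficients h u = (\<chi> i j. if i = j then 0 else partial j (\<lambda>x. h x $ i) u / h u $ j)"

text \<open>The inner product of the type \<^typ>\<open>complex^'n\<close> is the real one,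
  \<open>Z\<^sub>1 \<bullet> Z\<^sub>2 = Re (Z\<^sub>1\<^sup>* Z\<^sub>2)\<close>.\<close>

definition immersion_on :: "(real^'n) set \<Rightarrow> (real^'n \<Rightarrow> complex^'n) \<Rightarrow> bool" where
  "immersion_on U Y \<longleftrightarrow> smooth_on U Y \<and> (\<forall>u\<in>U. inj (frechet_derivative Y (at u)))"

definition lagrangian_on :: "(real^'n) set \<Rightarrow> (real^'n \<Rightarrow> complex^'n) \<Rightarrow> bool" where
  "lagrangian_on U Y \<longleftrightarrow> (\<forall>u\<in>U. \<forall>v w.
     Im (\<Sum>k\<in>UNIV. cnj (frechet_derivative Y (at u) v $ k) * frechet_derivative Y (at u) w $ k) = 0)"

definition first_form :: "(real^'n \<Rightarrow> complex^'n) \<Rightarrow> real^'n \<Rightarrow> real^'n^'n" where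
  "first_form Y u = (\<chi> i j. partial i Y u \<bullet> partial j Y u)"

definition flat_lagrangian_immersion_on :: "(real^'n) set \<Rightarrow> (real^'n \<Rightarrow> complex^'n) \<Rightarrow> bool" where
  "flat_lagrangian_immersion_on U Y \<longleftrightarrow>
     immersion_on U Y \<and> lagrangian_on U Y \<and> flat_metric_on U (first_form Y)"

definition tangent_space :: "(real^'n \<Rightarrow> complex^'n) \<Rightarrow> real^'n \<Rightarrow> (complex^'n) set" where
  "tangent_space Y u = range (frechet_derivative Y (at u))"

definition normal_space :: "(real^'n \<Rightarrow> complex^'n) \<Rightarrow> real^'n \<Rightarrow> (complex^'n) set" where
  "normal_space Y u = {\<xi>. \<forall>w\<in>tangent_space Y u. \<xi> \<bullet> w = 0}"

definition normal_part :: "(real^'n \<Rightarrow> complex^'n) \<Rightarrow> real^'n \<Rightarrow> complex^'n \<Rightarrow> complex^'n" where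
  "normal_part Y u Z = (THE \<xi>. \<xi> \<in> normal_space Y u \<and> Z - \<xi> \<in> tangent_space Y u)"

definition second_form ::
  "(real^'n \<Rightarrow> complex^'n) \<Rightarrow> real^'n \<Rightarrow> real^'n \<Rightarrow> real^'n \<Rightarrow> complex^'n" where
  "second_form Y u v w =
     normal_part Y u (frechet_derivative (\<lambda>x. frechet_derivative Y (at x) w) (at u) v)"

text \<open>Shape operators are written as matrices in the coordinates \<open>u\<close>; the codimension of an
  immersion of an \<open>n\<close>-dimensional domain into complex \<open>n\<close>-space is \<open>n\<close>.\<close>
definition shape_operators :: "(real^'n \<Rightarrow> complex^'n) \<Rightarrow> real^'n \<Rightarrow> (real^'n^'n) set" where
  "shape_operators Y u = {A. \<exists>\<xi>\<in>normal_space Y u. \<forall>v w.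
     frechet_derivative Y (at u) (A *v v) \<bullet> frechet_derivative Y (at u) w = second_form Y u v w \<bullet> \<xi>}"

definition nondegenerate_normal_bundle_on :: "(real^'n) set \<Rightarrow> (real^'n \<Rightarrow> complex^'n) \<Rightarrow> bool" where
  "nondegenerate_normal_bundle_on U Y \<longleftrightarrow> (\<forall>u\<in>U. dim (shape_operators Y u) = CARD('n))"

text \<open>The geometric properties of the associated family; only the real non-zero parameters matter.\<close>
definition flat_lagrangian_family_on ::
  "(real^'n) set \<Rightarrow> (real^'n \<Rightarrow> real^'n) \<Rightarrow> (real^'n \<Rightarrow> complex \<Rightarrow> complex^'n) \<Rightarrow> bool" where
  "flat_lagrangian_family_on U h X \<longleftrightarrow> (\<forall>t::real. t \<noteq> 0 \<longrightarrow>
     (let Y = (\<lambda>u. X u (complex_of_real t)) in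
        flat_lagrangian_immersion_on U Y \<and> nondegenerate_normal_bundle_on U Y \<and>
        (\<forall>u\<in>U. first_form Y u = diagonal_metric h u) \<and>
        (\<forall>u\<in>U. \<forall>v w. second_form Y u v w =
            t *\<^sub>R (\<Sum>i\<in>UNIV. (v $ i * w $ i) *\<^sub>R (\<i> *s partial i Y u)))))"

definition complex_vec :: "real^'n \<Rightarrow> complex^'n" where
  "complex_vec v = (\<chi> i. complex_of_real (v $ i))"

definition complex_mat :: "real^'n^'m \<Rightarrow> complex^'n^'m" where
  "complex_mat A = (\<chi> i j. complex_of_real (A $ i $ j))"

text \<open>The \<open>(n+1) \<times> (n+1)\<close> matrix with rows \<open>(A, x)\<close> and \<open>(0, c)\<close>; the last index is
  \<^term>\<open>None\<close>.\<close>
definition affine_block :: "complex^'n^'n \<Rightarrow> complex^'n \<Rightarrow> complex \<Rightarrow> complex^('n option)^('n option)" where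
  "affine_block A x c = (\<chi> r s. case r of
       None \<Rightarrow> (case s of None \<Rightarrow> c | Some j \<Rightarrow> 0)
     | Some i \<Rightarrow> (case s of None \<Rightarrow> x $ i | Some j \<Rightarrow> A $ i $ j))"

definition entrywise_holomorphic_on :: "(complex \<Rightarrow> complex^'m^'m) \<Rightarrow> complex set \<Rightarrow> bool" where
  "entrywise_holomorphic_on M S \<longleftrightarrow> (\<forall>r s. (\<lambda>z. M z $ r $ s) holomorphic_on S)"

text \<open>\<open>F\<^sup>-\<^sup>1 dF\<close> at the point \<open>u\<close>, evaluated on the tangent vector \<open>v\<close>.\<close>
definition maurer_cartan :: "(real^'n \<Rightarrow> complex^'m^'m) \<Rightarrow> real^'n \<Rightarrow> real^'n \<Rightarrow> complex^'m^'m" where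
  "maurer_cartan F u v = matrix_inv (F u) ** frechet_derivative F (at u) v"

text \<open>The matrix with rows \<open>(\<i>z\<delta> + [\<delta>,\<beta>], \<delta>h)\<close> and \<open>(0, 0)\<close>, evaluated on \<open>v\<close>;
  \<open>\<delta>\<close> evaluated on \<open>v\<close> is \<^term>\<open>diag_matrix v\<close>.\<close>
definition connection_form ::
  "real^'n^'n \<Rightarrow> real^'n \<Rightarrow> complex \<Rightarrow> real^'n \<Rightarrow> complex^('n option)^('n option)" where
  "connection_form \<beta> h z v = (let \<delta> = diag_matrix v in
     affine_block ((\<chi> i j. \<i> * z * complex_mat \<delta> $ i $ j) + complex_mat (\<delta> ** \<beta> - \<beta> ** \<delta>))
       (complex_vec (\<delta> *v h)) 0)"

definition frame_equation_on ::
  "(real^'n) set \<Rightarrow> (real^'n \<Rightarrow> real^'n^'n) \<Rightarrow> (real^'n \<Rightarrow> real^'n) \<Rightarrow>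
   (real^'n \<Rightarrow> complex \<Rightarrow> complex^('n option)^('n option)) \<Rightarrow> bool" where
  "frame_equation_on U \<beta> h F \<longleftrightarrow> (\<forall>u\<in>U. entrywise_holomorphic_on (F u) UNIV \<and>
     (\<forall>z. invertible (F u z) \<and> (\<lambda>x. F x z) differentiable (at u) \<and>
        (\<forall>v. maurer_cartan (\<lambda>x. F x z) u v = connection_form (\<beta> u) (h u) z v)))"

definition extended_frame_on ::
  "(real^'n) set \<Rightarrow> (real^'n \<Rightarrow> real^'n) \<Rightarrow>
   (real^'n \<Rightarrow> complex \<Rightarrow> complex^('n option)^('n option)) \<Rightarrow> bool" where
  "extended_frame_on U h F \<longleftrightarrow> frame_equation_on U (rotation_coefficients h) h F \<and> (\<forall>z. F 0 z = mat 1)"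

text \<open>Holomorphic near \<open>\<infinity>\<close> with value \<open>I\<close> there, expressed in the chart \<open>w = 1/z\<close>.\<close>
definition holomorphic_normalised_at_infinity :: "(complex \<Rightarrow> complex^'m^'m) \<Rightarrow> bool" where
  "holomorphic_normalised_at_infinity k \<longleftrightarrow>
     (\<exists>r>0. entrywise_holomorphic_on (\<lambda>w. if w = 0 then mat 1 else k (1 / w)) (ball 0 r))"

text \<open>\<open>G\<close> is the entire factor in \<open>k F = G k'\<close>. As in any loop group factorization it takes
  values in the invertible matrices. The equation is an identity of germs at \<open>\<infinity>\<close>, since
  \<open>k'\<close> need only exist there.\<close>
definition dressing_on ::
  "(real^'n) set \<Rightarrow> (complex \<Rightarrow> complex^'m^'m) \<Rightarrow> (real^'n \<Rightarrow> complex \<Rightarrow> complex^'m^'m) \<Rightarrow>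
   (real^'n \<Rightarrow> complex \<Rightarrow> complex^'m^'m) \<Rightarrow> bool" where
  "dressing_on U k F G \<longleftrightarrow> (\<forall>u\<in>U. entrywise_holomorphic_on (G u) UNIV \<and>
     (\<forall>z. invertible (G u z)) \<and>
     (\<exists>k'. holomorphic_normalised_at_infinity k' \<and>
        (\<forall>\<^sub>F z in at_infinity. k z ** F u z = G u z ** k' z)))"

definition simple_element :: "complex \<Rightarrow> real^'n \<Rightarrow> complex \<Rightarrow> complex^('n option)^('n option)" where
  "simple_element a b z = affine_block (mat 1) ((\<i> / (z - a)) *s complex_vec b) 1"

end

theory Submission
  imports Defs "HOL-Complex_Analysis.Cauchy_Integral_Formula"
begin

text \<open>Write \<open>A(z) = \<i>z\<delta> + [\<delta>,\<beta>]\<close>, so that \<open>dE = E A(z)\<close> and \<open>dX = E \<delta>h\<close>. Dressing by the simple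
  element keeps \<open>E\<close> and \<open>\<beta>\<close> and changes only \<open>X\<close> and \<open>h\<close>, in terms of \<open>g = E(\<cdot>,\<i>\<alpha>)\<^sup>-\<^sup>1 b\<close>.

  Since \<open>\<beta>\<close> is real and symmetric, \<open>A(z)\<^sup>t = - A(-z)\<close> and \<open>A\<close> at \<open>z\<close> is the conjugate of
  \<open>A\<close> at minus the conjugate of \<open>z\<close>. So \<open>E(z) E(-z)\<^sup>t\<close> and a similar product with a conjugated factor
  have derivative zero and equal \<open>I\<close> on the connected domain (\<open>frame_product_constant\<close>). Consequently
  \<open>E(z)\<^sup>-\<^sup>1 = E(-z)\<^sup>t\<close>, which is entire in \<open>z\<close>; \<open>E\<close> is real on the imaginary axis, hence so is \<open>g\<close>;
  and \<open>E(t)\<close> is unitary for real \<open>t\<close>.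

  From \<open>dg = - A(\<i>\<alpha>) g\<close> and \<open>A(z) - A(\<i>\<alpha>) = \<i>(z - \<i>\<alpha>)\<delta>\<close> one gets
  \<open>d(E(z) g) = \<i>(z - \<i>\<alpha>) E(z) \<delta>g\<close> (\<open>dress_residue_deriv\<close>). As \<open>b - E(z) g\<close> vanishes at \<open>z = \<i>\<alpha>\<close>, the function
  \<open>X + \<i>(b - E(z) g)/(z - \<i>\<alpha>)\<close> extends to an entire function of \<open>z\<close> whose differential is \<open>E \<delta>(h + g)\<close>.
  At the removable singularity the differential is obtained as a locally uniform limit
  (\<open>uniform_limit_E\<close>, \<open>dress_X_deriv_pole\<close>). Hence the dressed pair solves the frame equation for the
  same \<open>\<beta>\<close>, with \<open>h + g\<close> in place of \<open>h\<close>, and the second factor of the factorization is the simple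
  element with the same pole and \<open>g\<close> in place of \<open>b\<close>. The factorization is unique by Liouville's theorem
  (\<open>dressing_factor_unique\<close>).

  The geometric properties follow from the frame equation and the symmetries, so they hold
  for the dressed data for the same reasons as for the original ones, wherever \<open>h + g\<close> has no zero entry. For real \<open>t\<close> the unitary matrix
  \<open>E(t)\<close> maps \<open>\<real>\<^sup>n\<close> onto the tangent space and \<open>\<i>\<real>\<^sup>n\<close> onto the normal space, which gives
  both fundamental forms and identifies the shape operators with the diagonal matrices
  (\<open>flat_lagrangian_family_X\<close>). At \<open>z = 0\<close> the frame is real and \<open>Re X(\<cdot>,0)\<close> is a local isometry
  into \<open>\<real>\<^sup>n\<close>, so the metric is flat (\<open>flat_metric_on_diagonal_metric\<close>). Finally \<open>\<partial>\<^sub>j g\<^sub>i = \<beta>\<^sub>i\<^sub>j g\<^sub>j\<close> for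
  \<open>i \<noteq> j\<close>, so the rotation coefficients are unchanged, and
  \<open>\<phi> + 2 b \<cdot> Re X(\<cdot>,-\<i>\<alpha>) + \<bar>g\<bar>\<^sup>2/(2\<alpha>)\<close> is a potential of the new metric.\<close>

section \<open>Smooth functions\<close>

lemma frechet_derivative_cong_open:
  assumes "open U" "x \<in> U" "\<And>y. y \<in> U \<Longrightarrow> f y = g y"
  shows "frechet_derivative f (at x) = frechet_derivative g (at x)"
proof -
  have "(f has_derivative D) (at x) \<longleftrightarrow> (g has_derivative D) (at x)" for D
    using has_derivative_transform_within_open[OF _ assms(1,2), of f D UNIV g]
      has_derivative_transform_within_open[OF _ assms(1,2), of g D UNIV f] assms(3) by metis
  then show ?thesis unfolding frechet_derivative_def by simp
qed

lemma differentiable_cong_open: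
  assumes "open U" "x \<in> U" "\<And>y. y \<in> U \<Longrightarrow> f y = g y"
  shows "f differentiable (at x) \<longleftrightarrow> g differentiable (at x)"
proof -
  have "(f has_derivative D) (at x) \<longleftrightarrow> (g has_derivative D) (at x)" for D
    using has_derivative_transform_within_open[OF _ assms(1,2), of f D UNIV g]
      has_derivative_transform_within_open[OF _ assms(1,2), of g D UNIV f] assms(3) by metis
  then show ?thesis unfolding differentiable_def by simp
qed

lemma frechet_derivative_bounded_linear:
  assumes "bounded_linear L" "f differentiable (at x)"
  shows "frechet_derivative (\<lambda>y. L (f y)) (at x) v = L (frechet_derivative f (at x) v)"
  using frechet_derivative_at[OF bounded_linear.has_derivative[OF assms(1)
        frechet_derivative_works[THEN iffD1, OF assms(2)]]] by (simp add: fun_eq_iff)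

lemma Ck_on_cong:
  assumes "open U" "\<And>x. x \<in> U \<Longrightarrow> f x = g x"
  shows "Ck_on k U f \<longleftrightarrow> Ck_on k U g"
  using assms(2)
proof (induction k arbitrary: f g)
  case 0
  then show ?case by (simp cong: continuous_on_cong)
next
  case (Suc k)
  have "Ck_on k U (\<lambda>x. frechet_derivative f (at x) v) \<longleftrightarrow> Ck_on k U (\<lambda>x. frechet_derivative g (at x) v)"
    for v
    by (rule Suc.IH) (simp add: frechet_derivative_cong_open[OF assms(1) _ Suc.prems])
  moreover have "f differentiable (at x) \<longleftrightarrow> g differentiable (at x)" if "x \<in> U" for x
    by (rule differentiable_cong_open[OF assms(1) that Suc.prems])
  ultimately show ?case by simp
qed

text \<open>Any derivative will do in place of \<open>frechet_derivative\<close>, so that Leibniz-type formulas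
  can be used as they come. Gaining one order from the derivative is what bootstraps solutions of
  differential equations.\<close>

lemma Ck_on_SucI:
  assumes "open U" and deriv: "\<And>x. x \<in> U \<Longrightarrow> (f has_derivative f' x) (at x)"
    and f': "\<And>v. Ck_on k U (\<lambda>x. f' x v)"
  shows "Ck_on (Suc k) U f"
  unfolding Ck_on.simps
proof (intro conjI ballI allI)
  show "f differentiable (at x)" if "x \<in> U" for x
    using deriv[OF that] by (rule differentiableI)
  fix v
  have "frechet_derivative f (at x) v = f' x v" if "x \<in> U" for x
    using frechet_derivative_at[OF deriv[OF that]] by simp
  from iffD2[OF Ck_on_cong[OF assms(1) this] f'[of v]]
  show "Ck_on k U (\<lambda>x. frechet_derivative f (at x) v)" .
qed

lemma Ck_on_SucD: "Ck_on (Suc k) U f \<Longrightarrow> Ck_on k U f"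
proof (induction k arbitrary: f)
  case 0
  then show ?case
    by (auto intro!: continuous_at_imp_continuous_on differentiable_imp_continuous_within)
next
  case (Suc k)
  then show ?case by (metis Ck_on.simps(2))
qed

lemma Ck_on_Suc_has_derivative:
  "Ck_on (Suc k) U f \<Longrightarrow> x \<in> U \<Longrightarrow> (f has_derivative frechet_derivative f (at x)) (at x)"
  using frechet_derivative_works by auto

lemma Ck_on_Suc_directional:
  "Ck_on (Suc k) U f \<Longrightarrow> Ck_on k U (\<lambda>x. frechet_derivative f (at x) v)"
  by simp

lemma Ck_on_const: "Ck_on k U (\<lambda>x. c)"
  by (induction k arbitrary: c) auto

lemma Ck_on_bounded_linear:
  assumes "open U" "bounded_linear L"
  shows "Ck_on k U f \<Longrightarrow> Ck_on k U (\<lambda>x. L (f x))"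
proof (induction k arbitrary: f)
  case 0
  then show ?case using bounded_linear.continuous_on[OF assms(2)] by simp
next
  case (Suc k)
  show ?case
  proof (rule Ck_on_SucI[OF assms(1)])
    show "((\<lambda>x. L (f x)) has_derivative (\<lambda>v. L (frechet_derivative f (at x) v))) (at x)" if "x \<in> U" for x
      by (rule bounded_linear.has_derivative[OF assms(2) Ck_on_Suc_has_derivative[OF Suc.prems that]])
    show "Ck_on k U (\<lambda>x. L (frechet_derivative f (at x) v))" for v
      by (rule Suc.IH[OF Ck_on_Suc_directional[OF Suc.prems]])
  qed
qed

lemma Ck_on_add:
  assumes "open U"
  shows "Ck_on k U f \<Longrightarrow> Ck_on k U g \<Longrightarrow> Ck_on k U (\<lambda>x. f x + g x)"
proof (induction k arbitrary: f g)
  case 0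
  then show ?case by (simp add: continuous_on_add)
next
  case (Suc k)
  show ?case
  proof (rule Ck_on_SucI[OF assms])
    show "((\<lambda>x. f x + g x) has_derivative
        (\<lambda>v. frechet_derivative f (at x) v + frechet_derivative g (at x) v)) (at x)" if "x \<in> U" for x
      by (rule has_derivative_add[OF Ck_on_Suc_has_derivative[OF Suc.prems(1) that]
            Ck_on_Suc_has_derivative[OF Suc.prems(2) that]])
    show "Ck_on k U (\<lambda>x. frechet_derivative f (at x) v + frechet_derivative g (at x) v)" for v
      by (rule Suc.IH[OF Suc.prems[THEN Ck_on_Suc_directional]])
  qed
qed

lemma Ck_on_bilinear:
  assumes "open U" "bounded_bilinear B"
  shows "Ck_on k U f \<Longrightarrow> Ck_on k U g \<Longrightarrow> Ck_on k U (\<lambda>x. B (f x) (g x))"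
proof (induction k arbitrary: f g)
  case 0
  then show ?case by (simp add: bounded_bilinear.continuous_on[OF assms(2)])
next
  case (Suc k)
  show ?case
  proof (rule Ck_on_SucI[OF assms(1)])
    show "((\<lambda>x. B (f x) (g x)) has_derivative
        (\<lambda>v. B (f x) (frechet_derivative g (at x) v) + B (frechet_derivative f (at x) v) (g x))) (at x)"
      if "x \<in> U" for x
      by (rule bounded_bilinear.FDERIV[OF assms(2) Ck_on_Suc_has_derivative[OF Suc.prems(1) that]
            Ck_on_Suc_has_derivative[OF Suc.prems(2) that]])
    show "Ck_on k U (\<lambda>x. B (f x) (frechet_derivative g (at x) v) + B (frechet_derivative f (at x) v) (g x))"
      for v
      by (rule Ck_on_add[OF assms(1) Suc.IH[OF Ck_on_SucD Ck_on_Suc_directional]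
            Suc.IH[OF Ck_on_Suc_directional Ck_on_SucD]]) (rule Suc.prems)+
  qed
qed

lemma Ck_on_inverse:
  fixes f :: "'a::real_normed_vector \<Rightarrow> real"
  assumes "open U" "\<And>x. x \<in> U \<Longrightarrow> f x \<noteq> 0"
  shows "Ck_on k U f \<Longrightarrow> Ck_on k U (\<lambda>x. inverse (f x))"
proof (induction k)
  case 0
  then show ?case using assms(2) by (auto intro!: continuous_on_inverse)
next
  case (Suc k)
  note mult = Ck_on_bilinear[OF assms(1) bounded_bilinear_mult]
  have inv: "Ck_on k U (\<lambda>x. inverse (f x))"
    by (rule Suc.IH[OF Ck_on_SucD[OF Suc.prems]])
  show ?case
  proof (rule Ck_on_SucI[OF assms(1)])
    show "((\<lambda>x. inverse (f x)) has_derivative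
        (\<lambda>v. - (inverse (f x) * frechet_derivative f (at x) v * inverse (f x)))) (at x)" if "x \<in> U" for x
      by (rule Deriv.has_derivative_inverse[OF assms(2)[OF that] Ck_on_Suc_has_derivative[OF Suc.prems that]])
    show "Ck_on k U (\<lambda>x. - (inverse (f x) * frechet_derivative f (at x) v * inverse (f x)))" for v
      by (rule Ck_on_bounded_linear[OF assms(1) bounded_linear_minus[OF bounded_linear_ident]
            mult[OF mult[OF inv Ck_on_Suc_directional[OF Suc.prems]] inv]])
  qed
qed

lemma smooth_onD_differentiable: "smooth_on U f \<Longrightarrow> x \<in> U \<Longrightarrow> f differentiable (at x)"
  unfolding smooth_on_def using Ck_on.simps(2) by blast

lemma smooth_onD_has_derivative:
  "smooth_on U f \<Longrightarrow> x \<in> U \<Longrightarrow> (f has_derivative frechet_derivative f (at x)) (at x)"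
  using smooth_onD_differentiable frechet_derivative_works by blast

lemma smooth_on_frechet_derivative:
  "smooth_on U f \<Longrightarrow> smooth_on U (\<lambda>x. frechet_derivative f (at x) v)"
  unfolding smooth_on_def using Ck_on_Suc_directional by blast

lemma smooth_on_imp_continuous_on: "smooth_on U f \<Longrightarrow> continuous_on U f"
  unfolding smooth_on_def using Ck_on.simps(1) by blast

lemma smooth_on_cong:
  "open U \<Longrightarrow> (\<And>x. x \<in> U \<Longrightarrow> f x = g x) \<Longrightarrow> smooth_on U f \<longleftrightarrow> smooth_on U g"
  unfolding smooth_on_def using Ck_on_cong by blast

lemma Ck_on_subset: "Ck_on k U f \<Longrightarrow> V \<subseteq> U \<Longrightarrow> Ck_on k V f"
  by (induction k arbitrary: f) (auto intro: continuous_on_subset)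

lemma smooth_on_subset: "smooth_on U f \<Longrightarrow> V \<subseteq> U \<Longrightarrow> smooth_on V f"
  unfolding smooth_on_def using Ck_on_subset by blast

lemma smooth_on_const: "smooth_on U (\<lambda>x. c)"
  unfolding smooth_on_def by (simp add: Ck_on_const)

lemma smooth_on_bounded_linear:
  "open U \<Longrightarrow> bounded_linear L \<Longrightarrow> smooth_on U f \<Longrightarrow> smooth_on U (\<lambda>x. L (f x))"
  unfolding smooth_on_def by (simp add: Ck_on_bounded_linear)

lemma smooth_on_add:
  "open U \<Longrightarrow> smooth_on U f \<Longrightarrow> smooth_on U g \<Longrightarrow> smooth_on U (\<lambda>x. f x + g x)"
  unfolding smooth_on_def by (simp add: Ck_on_add)

lemma smooth_on_bilinear:
  "open U \<Longrightarrow> bounded_bilinear B \<Longrightarrow> smooth_on U f \<Longrightarrow> smooth_on U g \<Longrightarrow>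
    smooth_on U (\<lambda>x. B (f x) (g x))"
  unfolding smooth_on_def by (simp add: Ck_on_bilinear)

lemma smooth_on_divide:
  fixes f g :: "'a::real_normed_vector \<Rightarrow> real"
  assumes "open U" "smooth_on U f" "smooth_on U g" "\<And>x. x \<in> U \<Longrightarrow> g x \<noteq> 0"
  shows "smooth_on U (\<lambda>x. f x / g x)"
  using assms unfolding smooth_on_def divide_inverse
  by (auto intro!: Ck_on_bilinear[OF _ bounded_bilinear_mult] Ck_on_inverse)

lemma smooth_on_sum:
  assumes "open U" "\<And>i. i \<in> I \<Longrightarrow> smooth_on U (f i)"
  shows "smooth_on U (\<lambda>x. \<Sum>i\<in>I. f i x)"
  using assms(2)
  by (induction I rule: infinite_finite_induct) (auto intro: smooth_on_const smooth_on_add[OF assms(1)])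

lemma smooth_on_derivI:
  assumes "open U" "\<And>x. x \<in> U \<Longrightarrow> (f has_derivative f' x) (at x)"
    and "\<And>v. smooth_on U (\<lambda>x. f' x v)"
  shows "smooth_on U f"
proof -
  have "Ck_on k U f" for k
    using assms(3) by (intro Ck_on_SucD[OF Ck_on_SucI[OF assms(1,2)]]) (simp_all add: smooth_on_def)
  then show ?thesis by (simp add: smooth_on_def)
qed

lemma norm_axis_le: "norm (axis i x :: 'a::real_normed_vector^'n) \<le> norm x"
  unfolding norm_vec_def
  by (rule order_trans[OF L2_set_le_sum]) (simp_all add: axis_def if_distrib[of norm] cong: if_cong)

lemma bounded_linear_axis: "bounded_linear (\<lambda>c::'a::real_normed_vector. axis (i::'n::finite) c)"
proof
  show "axis i (b + c) = axis i b + axis i c" for b c :: 'a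
    by (simp add: vec_eq_iff axis_def)
  show "axis i (r *\<^sub>R b) = r *\<^sub>R axis i b" for r and b :: 'a
    by (simp add: vec_eq_iff axis_def)
  have "norm (axis i x) \<le> norm x * 1" for x :: 'a by (simp add: norm_axis_le)
  then show "\<exists>K. \<forall>x::'a. norm (axis i x) \<le> norm x * K" by blast
qed

lemma smooth_on_vec_iff:
  fixes f :: "'a::real_normed_vector \<Rightarrow> ('b::real_normed_vector)^'n"
  assumes "open U"
  shows "smooth_on U f \<longleftrightarrow> (\<forall>i. smooth_on U (\<lambda>x. f x $ i))"
proof
  assume "\<forall>i. smooth_on U (\<lambda>x. f x $ i)"
  then have "smooth_on U (\<lambda>x. \<Sum>i\<in>UNIV. axis i (f x $ i))"
    by (intro smooth_on_sum smooth_on_bounded_linear[OF _ bounded_linear_axis] assms) auto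
  moreover have "(\<Sum>i\<in>UNIV. axis i (v $ i)) = v" for v :: "'b^'n"
    by (simp add: vec_eq_iff axis_def sum.delta if_distrib cong: if_cong)
  ultimately show "smooth_on U f" by simp
qed (auto intro!: smooth_on_bounded_linear[OF assms bounded_linear_vec_nth])

section \<open>Symmetry of second derivatives\<close>

text \<open>Two applications of the mean value theorem to the second difference of \<open>f\<close> along \<open>v\<close> and
  \<open>w\<close>. Since that difference is symmetric in \<open>v\<close> and \<open>w\<close>, so are the second derivatives.\<close>

lemma second_difference_mean_value:
  fixes f :: "'a::real_normed_vector \<Rightarrow> real"
  assumes t: "t > 0"
    and f: "\<And>y. y \<in> S \<Longrightarrow> f differentiable (at y)"
    and fv: "\<And>y. y \<in> S \<Longrightarrow> (\<lambda>z. frechet_derivative f (at z) v) differentiable (at y)"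
    and S: "\<And>s r. 0 \<le> s \<Longrightarrow> s \<le> t \<Longrightarrow> 0 \<le> r \<Longrightarrow> r \<le> t \<Longrightarrow> x + s *\<^sub>R v + r *\<^sub>R w \<in> S"
  obtains s r where "0 < s" "s < t" "0 < r" "r < t"
    "f (x + t *\<^sub>R v + t *\<^sub>R w) - f (x + t *\<^sub>R v) - f (x + t *\<^sub>R w) + f x =
      t * (t * frechet_derivative (\<lambda>z. frechet_derivative f (at z) v) (at (x + s *\<^sub>R v + r *\<^sub>R w)) w)"
proof -
  have line: "((\<lambda>s. k (y + s *\<^sub>R d)) has_real_derivative frechet_derivative k (at (y + s *\<^sub>R d)) d) (at s)"
    if "k differentiable (at (y + s *\<^sub>R d))" for k :: "'a \<Rightarrow> real" and y d s
  proof -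
    have "(k has_derivative frechet_derivative k (at (y + s *\<^sub>R d))) (at (y + s *\<^sub>R d))"
      using that by (simp flip: frechet_derivative_works)
    moreover have "((\<lambda>s. y + s *\<^sub>R d) has_derivative (\<lambda>h. h *\<^sub>R d)) (at s)"
      by (auto intro!: derivative_eq_intros)
    ultimately have "((\<lambda>s. k (y + s *\<^sub>R d)) has_derivative
        (\<lambda>h. frechet_derivative k (at (y + s *\<^sub>R d)) (h *\<^sub>R d))) (at s)"
      using has_derivative_compose by blast
    then show ?thesis
      by (simp add: has_field_derivative_def linear_scale[OF linear_frechet_derivative[OF that]]
          mult_commute_abs)
  qed
  have 1: "((\<lambda>s. f (x + s *\<^sub>R v + t *\<^sub>R w) - f (x + s *\<^sub>R v)) has_real_derivative
       frechet_derivative f (at (x + s *\<^sub>R v + t *\<^sub>R w)) v - frechet_derivative f (at (x + s *\<^sub>R v)) v) (at s)"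
    if "0 \<le> s" "s \<le> t" for s
  proof (rule DERIV_diff)
    show "((\<lambda>s. f (x + s *\<^sub>R v + t *\<^sub>R w)) has_real_derivative
        frechet_derivative f (at (x + s *\<^sub>R v + t *\<^sub>R w)) v) (at s)"
      using line[of f "x + t *\<^sub>R w" s v] f[OF S[of s t]] that t by (simp add: algebra_simps)
    show "((\<lambda>s. f (x + s *\<^sub>R v)) has_real_derivative frechet_derivative f (at (x + s *\<^sub>R v)) v) (at s)"
      using line[of f x s v] f[OF S[of s 0]] that t by simp
  qed
  obtain s where s: "0 < s" "s < t" and
    fs: "(f (x + t *\<^sub>R v + t *\<^sub>R w) - f (x + t *\<^sub>R v)) - (f (x + 0 *\<^sub>R v + t *\<^sub>R w) - f (x + 0 *\<^sub>R v)) =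
      (t - 0) * (frechet_derivative f (at (x + s *\<^sub>R v + t *\<^sub>R w)) v - frechet_derivative f (at (x + s *\<^sub>R v)) v)"
    using MVT2[OF t 1] by auto
  define k where "k y = frechet_derivative f (at y) v" for y
  obtain r where r: "0 < r" "r < t" and
    fr: "k (x + s *\<^sub>R v + t *\<^sub>R w) - k (x + s *\<^sub>R v + 0 *\<^sub>R w) =
      (t - 0) * frechet_derivative k (at (x + s *\<^sub>R v + r *\<^sub>R w)) w"
    using MVT2[OF t, of "\<lambda>r. k (x + s *\<^sub>R v + r *\<^sub>R w)"
        "\<lambda>r. frechet_derivative k (at (x + s *\<^sub>R v + r *\<^sub>R w)) w"]
      line[of k "x + s *\<^sub>R v" _ w] fv[OF S[of s]] s unfolding k_def by auto
  show thesis
    using that[OF s r] fs[simplified, folded k_def] fr[simplified] unfolding k_def[symmetric] by simp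
qed

lemma second_derivative_symmetric_real:
  fixes f :: "'a::real_normed_vector \<Rightarrow> real"
  assumes "open S" "x \<in> S" "smooth_on S f"
  shows "frechet_derivative (\<lambda>y. frechet_derivative f (at y) v) (at x) w =
    frechet_derivative (\<lambda>y. frechet_derivative f (at y) w) (at x) v"
    (is "?a v w x = ?a w v x")
proof (rule ccontr)
  assume neq: "?a v w x \<noteq> ?a w v x"
  define e where "e = \<bar>?a v w x - ?a w v x\<bar> / 2"
  have e: "e > 0" using neq by (simp add: e_def)
  have cont: "continuous_on S (?a v w)" for v w
    by (intro smooth_on_imp_continuous_on smooth_on_frechet_derivative assms(3))
  have near: "\<exists>d>0. \<forall>y\<in>S. dist y x < d \<longrightarrow> \<bar>?a v w y - ?a v w x\<bar> < e" for v w
    using cont[of v w] assms(2) e unfolding continuous_on_iff dist_real_def by blast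
  obtain d1 where d1: "d1 > 0" "\<And>y. y \<in> S \<Longrightarrow> dist y x < d1 \<Longrightarrow> \<bar>?a v w y - ?a v w x\<bar> < e"
    using near[of v w] by blast
  obtain d2 where d2: "d2 > 0" "\<And>y. y \<in> S \<Longrightarrow> dist y x < d2 \<Longrightarrow> \<bar>?a w v y - ?a w v x\<bar> < e"
    using near[of w v] by blast
  obtain d3 where d3: "d3 > 0" "ball x d3 \<subseteq> S"
    using assms(1,2) openE by blast
  define d where "d = min d1 (min d2 d3)"
  define c where "c = norm v + norm w + 1"
  define t where "t = d / (2 * c)"
  have d: "d > 0" using d1 d2 d3 by (simp add: d_def)
  have c: "c > 0" unfolding c_def by (simp add: add_nonneg_pos)
  then have t: "t > 0" using d by (simp add: t_def)
  have close: "dist (x + s *\<^sub>R v + r *\<^sub>R w) x < d" "dist (x + s *\<^sub>R w + r *\<^sub>R v) x < d"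
    if "0 \<le> s" "s \<le> t" "0 \<le> r" "r \<le> t" for s r
  proof -
    have *: "norm (s *\<^sub>R a + r *\<^sub>R b) \<le> t * (norm a + norm b)" for a b :: 'a
      using that by (intro order_trans[OF norm_triangle_ineq])
        (simp add: distrib_left add_mono mult_right_mono)
    have "t * (norm v + norm w) \<le> t * c" using t by (simp add: c_def)
    also have "\<dots> = d / 2"
      unfolding t_def using c by simp
    finally have "t * (norm v + norm w) < d" using d by simp
    then show "dist (x + s *\<^sub>R v + r *\<^sub>R w) x < d" "dist (x + s *\<^sub>R w + r *\<^sub>R v) x < d"
      using *[of v w] *[of w v] by (auto simp: dist_norm add.assoc add.commute[of "norm w"])
  qed
  have inS: "y \<in> S" if "dist y x < d" for y
    using that d3 by (auto simp: d_def dist_commute)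
  have dif: "f differentiable (at y)" "(\<lambda>z. frechet_derivative f (at z) v) differentiable (at y)"
    if "y \<in> S" for y v
    using that assms(3) by (auto intro: smooth_onD_differentiable smooth_on_frechet_derivative)
  obtain s r where sr: "0 < s" "s < t" "0 < r" "r < t"
    "f (x + t *\<^sub>R v + t *\<^sub>R w) - f (x + t *\<^sub>R v) - f (x + t *\<^sub>R w) + f x =
      t * (t * ?a v w (x + s *\<^sub>R v + r *\<^sub>R w))"
    by (rule second_difference_mean_value[OF t dif, of S x v w]) (auto intro: inS close)
  obtain s' r' where sr': "0 < s'" "s' < t" "0 < r'" "r' < t"
    "f (x + t *\<^sub>R w + t *\<^sub>R v) - f (x + t *\<^sub>R w) - f (x + t *\<^sub>R v) + f x =
      t * (t * ?a w v (x + s' *\<^sub>R w + r' *\<^sub>R v))"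
    by (rule second_difference_mean_value[OF t dif, of S x w v]) (auto intro: inS close)
  have swap: "x + t *\<^sub>R w + t *\<^sub>R v = x + t *\<^sub>R v + t *\<^sub>R w"
    by (simp add: ac_simps)
  have "t * (t * ?a v w (x + s *\<^sub>R v + r *\<^sub>R w)) = t * (t * ?a w v (x + s' *\<^sub>R w + r' *\<^sub>R v))"
    using sr(5) sr'(5)[unfolded swap] by linarith
  then have "?a v w (x + s *\<^sub>R v + r *\<^sub>R w) = ?a w v (x + s' *\<^sub>R w + r' *\<^sub>R v)"
    using t by simp
  moreover have "\<bar>?a v w (x + s *\<^sub>R v + r *\<^sub>R w) - ?a v w x\<bar> < e"
    using close(1)[of s r] sr by (intro d1 inS) (auto simp: d_def)
  moreover have "\<bar>?a w v (x + s' *\<^sub>R w + r' *\<^sub>R v) - ?a w v x\<bar> < e"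
    using close(2)[of s' r'] sr' by (intro d2 inS) (auto simp: d_def)
  moreover have False if "\<bar>p - a\<bar> < \<bar>a - b\<bar> / 2" "\<bar>p - b\<bar> < \<bar>a - b\<bar> / 2" for a b p :: real
    using that by (simp add: abs_if split: if_splits)
  ultimately show False unfolding e_def by metis
qed

lemma second_derivative_symmetric:
  fixes f :: "'a::real_normed_vector \<Rightarrow> 'b::euclidean_space"
  assumes "open S" "x \<in> S" "smooth_on S f"
  shows "frechet_derivative (\<lambda>y. frechet_derivative f (at y) v) (at x) w =
    frechet_derivative (\<lambda>y. frechet_derivative f (at y) w) (at x) v"
proof (rule euclidean_eqI)
  fix b :: 'b
  note bl = bounded_linear_inner_left[of b]
  have eq: "frechet_derivative (\<lambda>y. f y \<bullet> b) (at y) v = frechet_derivative f (at y) v \<bullet> b"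
    if "y \<in> S" for y v
    using frechet_derivative_bounded_linear[OF bl] assms(3) that smooth_onD_differentiable by blast
  have "frechet_derivative (\<lambda>y. frechet_derivative (\<lambda>y. f y \<bullet> b) (at y) v) (at x) w =
      frechet_derivative (\<lambda>y. frechet_derivative f (at y) v) (at x) w \<bullet> b" for v w
    using frechet_derivative_cong_open[OF assms(1,2) eq]
      frechet_derivative_bounded_linear[OF bl smooth_onD_differentiable[OF smooth_on_frechet_derivative]]
      assms by fastforce
  then show "frechet_derivative (\<lambda>y. frechet_derivative f (at y) v) (at x) w \<bullet> b =
    frechet_derivative (\<lambda>y. frechet_derivative f (at y) w) (at x) v \<bullet> b"
    using second_derivative_symmetric_real[OF assms(1,2) smooth_on_bounded_linear[OF assms(1) bl assms(3)]]
    by metis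
qed

section \<open>Diagonal metrics induced by maps into Euclidean space\<close>

lemma partial_cong_open:
  assumes "open U" "u \<in> U" "\<And>y. y \<in> U \<Longrightarrow> f y = g y"
  shows "partial i f u = partial i g u"
  unfolding partial_def by (simp add: frechet_derivative_cong_open[OF assms])

lemma partial_eqI: "(f has_derivative D) (at u) \<Longrightarrow> partial i f u = D (axis i 1)"
  unfolding partial_def using frechet_derivative_at[of f D u] by simp

lemma smooth_on_partial: "smooth_on U f \<Longrightarrow> smooth_on U (partial i f)"
  unfolding partial_def by (rule smooth_on_frechet_derivative)

lemma matrix_inv_eqI:
  fixes A B :: "'a::field^'n^'n"
  assumes "A ** B = mat 1"
  shows "matrix_inv A = B"
proof -
  have BA: "B ** A = mat 1" by (rule iffD1[OF matrix_left_right_inverse assms])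
  have "A ** matrix_inv A = mat 1 \<and> matrix_inv A ** A = mat 1"
    unfolding matrix_inv_def by (rule someI[of _ B]) (simp add: assms BA)
  then have "matrix_inv A = (B ** A) ** matrix_inv A" by (simp add: BA)
  also have "\<dots> = B"
    using \<open>A ** matrix_inv A = mat 1 \<and> matrix_inv A ** A = mat 1\<close>
    by (simp flip: matrix_mul_assoc)
  finally show ?thesis .
qed

lemma diag_matrix_mult_vector: "diag_matrix v *v w = (\<chi> i. v $ i * w $ i)"
  by (simp add: vec_eq_iff diag_matrix_def matrix_vector_mult_def if_distrib[of "\<lambda>x. x * _"] cong: if_cong)

lemma matrix_inv_diag_matrix:
  fixes d :: "'a::field^'n"
  assumes "\<And>i. d $ i \<noteq> 0"
  shows "matrix_inv (diag_matrix d) = diag_matrix (\<chi> i. 1 / d $ i)"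
  by (rule matrix_inv_eqI)
    (simp add: vec_eq_iff diag_matrix_def matrix_matrix_mult_def mat_def assms
      if_distrib[of "\<lambda>x. x * _"] cong: if_cong)

lemma riemannian_metric_on_diagonal_metric:
  fixes h :: "real^'n \<Rightarrow> real^'n"
  assumes "open U" "smooth_on U h" "\<And>u i. u \<in> U \<Longrightarrow> h u $ i \<noteq> 0"
  shows "riemannian_metric_on U (diagonal_metric h)"
proof -
  have hi: "smooth_on U (\<lambda>u. h u $ i)" for i
    using assms(2) smooth_on_vec_iff[OF assms(1)] by blast
  have "smooth_on U (\<lambda>u. diagonal_metric h u $ i $ j)" for i j
    using smooth_on_bilinear[OF assms(1) bounded_bilinear_mult hi hi, of i i] smooth_on_const[of U 0]
    by (cases "i = j") (simp_all add: diagonal_metric_def diag_matrix_def power2_eq_square)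
  then have "smooth_on U (diagonal_metric h)"
    by (simp add: smooth_on_vec_iff[OF assms(1)])
  moreover have "transpose (diagonal_metric h u) = diagonal_metric h u" for u
    by (simp add: vec_eq_iff transpose_def diagonal_metric_def diag_matrix_def)
  moreover have "v \<bullet> (diagonal_metric h u *v v) > 0" if "u \<in> U" "v \<noteq> 0" for u v
  proof -
    obtain i where "v $ i \<noteq> 0" using \<open>v \<noteq> 0\<close> by (auto simp: vec_eq_iff)
    then have "(h u $ i * v $ i)\<^sup>2 > 0" using assms(3)[OF that(1)] by simp
    then have "(\<Sum>i\<in>UNIV. (h u $ i * v $ i)\<^sup>2) > 0"
      by (intro sum_pos2[of UNIV i]) auto
    then show ?thesis
      by (simp add: diagonal_metric_def diag_matrix_mult_vector inner_vec_def power2_eq_square mult_ac)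
  qed
  ultimately show ?thesis by (simp add: riemannian_metric_on_def)
qed

text \<open>A map into \<open>\<real>\<^sup>n\<close> whose partial derivatives are orthogonal with lengths \<open>\<bar>h\<^sub>i\<bar>\<close> is a local
  isometry. Its partial derivatives form a moving frame in which the Christoffel symbols are the
  coefficients of the second derivatives; the curvature then measures the failure of third
  derivatives to commute.\<close>

lemma flat_metric_on_diagonal_metric:
  fixes f h :: "real^'n \<Rightarrow> real^'n"
  assumes U: "open U" and f: "smooth_on U f" and h: "smooth_on U h"
    and h0: "\<And>u i. u \<in> U \<Longrightarrow> h u $ i \<noteq> 0"
    and orth: "\<And>u i j. u \<in> U \<Longrightarrow> partial i f u \<bullet> partial j f u = (if i = j then (h u $ i)\<^sup>2 else 0)"
  shows "flat_metric_on U (diagonal_metric h)"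
proof -
  define J where "J i = partial i f" for i
  define D where "D i j = partial i (J j)" for i j
  define \<Gamma> where "\<Gamma> k i j u = (D i j u \<bullet> J k u) / (h u $ k)\<^sup>2" for k i j u
  have J: "smooth_on U (J i)" for i unfolding J_def by (rule smooth_on_partial[OF f])
  have D: "smooth_on U (D i j)" for i j unfolding D_def by (rule smooth_on_partial[OF J])
  have Dsym: "D i j u = D j i u" if "u \<in> U" for i j u
    unfolding D_def J_def partial_def by (rule second_derivative_symmetric[OF U that f])
  have DDsym: "partial i (D j k) u = partial j (D i k) u" if "u \<in> U" for i j k u
    unfolding D_def partial_def by (rule second_derivative_symmetric[OF U that J])
  have JJ: "J i u \<bullet> J j u = (if i = j then (h u $ i)\<^sup>2 else 0)" if "u \<in> U" for i j u
    unfolding J_def by (rule orth[OF that])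

  have \<Gamma>: "smooth_on U (\<Gamma> k i j)" for k i j
    unfolding \<Gamma>_def power2_eq_square
    using h0 h smooth_on_vec_iff[OF U] by (intro smooth_on_divide smooth_on_bilinear[OF U bounded_bilinear_inner]
        smooth_on_bilinear[OF U bounded_bilinear_mult] D J U) auto

  have dg: "partial i (\<lambda>x. diagonal_metric h x $ j $ l) u = D i j u \<bullet> J l u + J j u \<bullet> D i l u"
    if "u \<in> U" for i j l u
  proof -
    have "partial i (\<lambda>x. diagonal_metric h x $ j $ l) u = partial i (\<lambda>x. J j x \<bullet> J l x) u"
      by (rule partial_cong_open[OF U that]) (simp add: JJ diagonal_metric_def diag_matrix_def)
    also have "\<dots> = J j u \<bullet> D i l u + D i j u \<bullet> J l u"
      unfolding D_def partial_def[of i "J _"]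
      by (rule partial_eqI[OF has_derivative_inner]) (rule smooth_onD_has_derivative[OF J that])+
    finally show ?thesis by simp
  qed
  have christoffel: "christoffel (diagonal_metric h) k i j u = \<Gamma> k i j u" if "u \<in> U" for k i j u
  proof -
    have inv: "matrix_inv (diagonal_metric h u) $ k $ l = (if k = l then 1 / (h u $ k)\<^sup>2 else 0)" for l
      unfolding diagonal_metric_def using h0[OF that]
      by (subst matrix_inv_diag_matrix) (auto simp: diag_matrix_def)
    show ?thesis
      unfolding christoffel_def inv dg[OF that]
      by (simp add: if_distrib[of "\<lambda>x. x * _"] \<Gamma>_def inner_commute Dsym[OF that, of j i]
          Dsym[OF that, of k i] Dsym[OF that, of k j] cong: if_cong)
  qed

  \<comment> \<open>the \<open>J\<^sub>k/h\<^sub>k\<close> are the columns of an orthogonal matrix\<close>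
  have expand: "w = (\<Sum>k\<in>UNIV. ((w \<bullet> J k u) / (h u $ k)\<^sup>2) *\<^sub>R J k u)" if "u \<in> U" for u w
  proof -
    define Q :: "real^'n^'n" where "Q = (\<chi> a k. J k u $ a / h u $ k)"
    have "(transpose Q ** Q) $ i $ j = (J i u \<bullet> J j u) / (h u $ i * h u $ j)" for i j
      by (simp add: Q_def transpose_def matrix_matrix_mult_def inner_vec_def sum_divide_distrib)
    then have "transpose Q ** Q = mat 1"
      using h0[OF that] by (simp add: vec_eq_iff JJ[OF that] mat_def power2_eq_square)
    then have "Q ** transpose Q = mat 1"
      by (rule iffD1[OF matrix_left_right_inverse])
    then have "(Q ** transpose Q) *v w = w" by simp
    then have "w = Q *v (transpose Q *v w)" by (metis matrix_vector_mul_assoc)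
    also have "transpose Q *v w = (\<chi> k. (w \<bullet> J k u) / h u $ k)"
      by (simp add: vec_eq_iff Q_def transpose_def matrix_vector_mult_def inner_vec_def sum_divide_distrib mult_ac)
    also have "Q *v \<dots> = (\<Sum>k\<in>UNIV. ((w \<bullet> J k u) / (h u $ k)\<^sup>2) *\<^sub>R J k u)"
      by (simp add: vec_eq_iff Q_def matrix_vector_mult_def power2_eq_square mult_ac)
    finally show ?thesis .
  qed
  \<comment> \<open>Gauss formula without normal component; \<open>dgauss\<close> differentiates it once more\<close>
  have gauss: "D i k u = (\<Sum>m\<in>UNIV. \<Gamma> m i k u *\<^sub>R J m u)" if "u \<in> U" for i k u
    unfolding \<Gamma>_def by (rule expand[OF that])
  have dgauss: "partial j (D i k) u =
      (\<Sum>m\<in>UNIV. partial j (\<Gamma> m i k) u *\<^sub>R J m u) + (\<Sum>m\<in>UNIV. \<Gamma> m i k u *\<^sub>R D j m u)"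
    if "u \<in> U" for i j k u
  proof -
    have "partial j (D i k) u = partial j (\<lambda>x. \<Sum>m\<in>UNIV. \<Gamma> m i k x *\<^sub>R J m x) u"
      by (rule partial_cong_open[OF U that gauss])
    also have "\<dots> = (\<Sum>m\<in>UNIV. \<Gamma> m i k u *\<^sub>R D j m u + partial j (\<Gamma> m i k) u *\<^sub>R J m u)"
      unfolding D_def partial_def[of j "J _"] partial_def[of j "\<Gamma> _ _ _"]
      by (rule partial_eqI, intro has_derivative_sum has_derivative_scaleR smooth_onD_has_derivative[OF J that]
          smooth_onD_has_derivative[OF \<Gamma> that])
    finally show ?thesis by (simp add: sum.distrib)
  qed

  have "riemann_curvature (diagonal_metric h) l k i j u = 0" if u: "u \<in> U" for l k i j u
  proof -
    define R where "R l = riemann_curvature (diagonal_metric h) l k i j u" for l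
    have R: "R l = partial i (\<Gamma> l j k) u - partial j (\<Gamma> l i k) u +
        ((\<Sum>m\<in>UNIV. \<Gamma> m j k u * \<Gamma> l i m u) - (\<Sum>m\<in>UNIV. \<Gamma> m i k u * \<Gamma> l j m u))" for l
      using partial_cong_open[OF U u christoffel]
      by (simp add: R_def riemann_curvature_def christoffel[OF u] sum_subtractf mult.commute)
    have swap: "(\<Sum>l\<in>UNIV. (\<Sum>m\<in>UNIV. \<Gamma> m j k u * \<Gamma> l i m u) *\<^sub>R J l u) = (\<Sum>m\<in>UNIV. \<Gamma> m j k u *\<^sub>R D i m u)"
      for i j
      unfolding gauss[OF u] scaleR_sum_right scaleR_sum_left scaleR_scaleR by (rule sum.swap)
    have "(\<Sum>l\<in>UNIV. R l *\<^sub>R J l u) = partial i (D j k) u - partial j (D i k) u"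
      unfolding R dgauss[OF u]
      by (simp add: scaleR_add_left scaleR_diff_left sum.distrib sum_subtractf swap)
    also have "\<dots> = 0" by (simp add: DDsym[OF u])
    finally have "(\<Sum>l\<in>UNIV. R l *\<^sub>R J l u) \<bullet> J l u = 0" by simp
    then have "R l * (h u $ l)\<^sup>2 = 0"
      by (simp add: inner_sum_left JJ[OF u] if_distrib[of "\<lambda>x. _ * x"] cong: if_cong)
    then show ?thesis using h0[OF u] by (simp add: R_def)
  qed
  then show ?thesis
    using riemannian_metric_on_diagonal_metric[OF U h h0] by (simp add: flat_metric_on_def)
qed

lemma flat_metric_on_cong:
  assumes U: "open U" and eq: "\<And>u. u \<in> U \<Longrightarrow> g u = g' u"
  shows "flat_metric_on U g \<longleftrightarrow> flat_metric_on U g'"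
proof -
  have entry: "partial i (\<lambda>x. g x $ a $ b) u = partial i (\<lambda>x. g' x $ a $ b) u" if "u \<in> U" for i a b u
    by (rule partial_cong_open[OF U that]) (simp add: eq)
  have christoffel: "christoffel g k i j u = christoffel g' k i j u" if "u \<in> U" for k i j u
    unfolding christoffel_def by (simp only: eq[OF that] entry[OF that])
  have "riemann_curvature g l k i j u = riemann_curvature g' l k i j u" if "u \<in> U" for l k i j u
    unfolding riemann_curvature_def
    by (simp only: christoffel[OF that] partial_cong_open[OF U that christoffel])
  then show ?thesis
    by (simp add: flat_metric_on_def riemannian_metric_on_def smooth_on_cong[OF U eq] eq cong: ball_cong)
qed

section \<open>Complex matrices\<close>

lemma bounded_bilinear_sum:
  assumes "finite I" "\<And>i. i \<in> I \<Longrightarrow> bounded_bilinear (B i)"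
  shows "bounded_bilinear (\<lambda>x y. \<Sum>i\<in>I. B i x y)"
  using assms
proof (induction I rule: finite_induct)
  case empty
  show ?case by standard (auto intro: exI[of _ 0])
next
  case (insert i I)
  interpret i: bounded_bilinear "B i" using insert by simp
  interpret I: bounded_bilinear "\<lambda>x y. \<Sum>i\<in>I. B i x y" using insert by simp
  obtain K L where K: "\<And>a b. norm (B i a b) \<le> norm a * norm b * K"
    and L: "\<And>a b. norm (\<Sum>i\<in>I. B i a b) \<le> norm a * norm b * L"
    using i.bounded I.bounded by blast
  have "bounded_bilinear (\<lambda>x y. B i x y + (\<Sum>i\<in>I. B i x y))"
  proof
    have "norm (B i a b + (\<Sum>i\<in>I. B i a b)) \<le> norm a * norm b * (K + L)" for a b
      using norm_triangle_le[OF add_mono[OF K L]] by (simp add: distrib_left)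
    then show "\<exists>K. \<forall>a b. norm (B i a b + (\<Sum>i\<in>I. B i a b)) \<le> norm a * norm b * K" by blast
  qed (simp_all add: i.add_left i.add_right I.add_left I.add_right i.scaleR_left i.scaleR_right
        I.scaleR_left I.scaleR_right scaleR_add_right)
  then show ?case using insert by simp
qed

lemma bounded_bilinear_vecI:
  fixes B :: "'a::real_normed_vector \<Rightarrow> 'b::real_normed_vector \<Rightarrow> 'c::real_normed_vector^'n"
  assumes "\<And>i. bounded_bilinear (\<lambda>x y. B x y $ i)"
  shows "bounded_bilinear B"
proof
  fix a a' :: 'a and b b' :: 'b and r :: real
  note B = bounded_bilinear.add_left[OF assms] bounded_bilinear.add_right[OF assms]
    bounded_bilinear.scaleR_left[OF assms] bounded_bilinear.scaleR_right[OF assms]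
  show "B (a + a') b = B a b + B a' b" "B a (b + b') = B a b + B a b'"
    "B (r *\<^sub>R a) b = r *\<^sub>R B a b" "B a (r *\<^sub>R b) = r *\<^sub>R B a b"
    by (simp_all add: vec_eq_iff B)
  have "\<forall>i. \<exists>K. \<forall>a b. norm (B a b $ i) \<le> norm a * norm b * K"
    using bounded_bilinear.bounded[OF assms] by blast
  then obtain K where K: "\<And>i a b. norm (B a b $ i) \<le> norm a * norm b * K i" by metis
  have "norm (B a b) \<le> norm a * norm b * (\<Sum>i\<in>UNIV. K i)" for a b
    unfolding norm_vec_def[of "B a b"] sum_distrib_left
    by (rule order_trans[OF L2_set_le_sum sum_mono]) (simp_all add: K)
  then show "\<exists>K. \<forall>a b. norm (B a b) \<le> norm a * norm b * K" by blast
qed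

lemma bounded_bilinear_matrix_mult:
  "bounded_bilinear ((**) :: complex^'n^'m \<Rightarrow> complex^'k^'n \<Rightarrow> complex^'k^'m)"
proof (intro bounded_bilinear_vecI)
  fix i :: 'm and j :: 'k
  have "bounded_bilinear (\<lambda>(A::complex^'n^'m) (B::complex^'k^'n). \<Sum>l\<in>UNIV. A $ i $ l * B $ l $ j)"
    by (intro bounded_bilinear_sum bounded_bilinear.comp[OF bounded_bilinear_mult]
        bounded_linear_compose[OF bounded_linear_vec_nth bounded_linear_vec_nth]) simp
  then show "bounded_bilinear (\<lambda>(A::complex^'n^'m) (B::complex^'k^'n). (A ** B) $ i $ j)"
    by (simp add: matrix_matrix_mult_def)
qed

lemma bounded_bilinear_matrix_vector_mult:
  "bounded_bilinear ((*v) :: complex^'n^'m \<Rightarrow> complex^'n \<Rightarrow> complex^'m)"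
proof (intro bounded_bilinear_vecI)
  fix i :: 'm
  have "bounded_bilinear (\<lambda>(A::complex^'n^'m) x. \<Sum>l\<in>UNIV. A $ i $ l * x $ l)"
    by (intro bounded_bilinear_sum bounded_bilinear.comp[OF bounded_bilinear_mult]
        bounded_linear_compose[OF bounded_linear_vec_nth bounded_linear_vec_nth] bounded_linear_vec_nth) simp
  then show "bounded_bilinear (\<lambda>(A::complex^'n^'m) x. (A *v x) $ i)"
    by (simp add: matrix_vector_mult_def)
qed

lemma matrix_inv_right: "invertible A \<Longrightarrow> A ** matrix_inv A = mat 1"
  unfolding invertible_def matrix_inv_def by (rule someI2_ex) auto

lemma matrix_inv_left: "invertible A \<Longrightarrow> matrix_inv A ** A = mat 1"
  unfolding invertible_def matrix_inv_def by (rule someI2_ex) auto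

lemma bounded_linear_transpose: "bounded_linear (transpose :: complex^'n^'m \<Rightarrow> complex^'m^'n)"
  unfolding linear_conv_bounded_linear[symmetric]
  by (rule linearI) (simp_all add: vec_eq_iff transpose_def)

definition cnj_mat :: "complex^'n^'m \<Rightarrow> complex^'n^'m" where
  "cnj_mat A = (\<chi> i j. cnj (A $ i $ j))"

lemma bounded_linear_cnj_mat: "bounded_linear (cnj_mat :: complex^'n^'m \<Rightarrow> complex^'n^'m)"
  unfolding linear_conv_bounded_linear[symmetric]
  by (rule linearI) (simp_all add: vec_eq_iff cnj_mat_def)

lemma cnj_mat_mult: "cnj_mat (A ** B) = cnj_mat A ** cnj_mat B"
  by (simp add: vec_eq_iff cnj_mat_def matrix_matrix_mult_def)

lemma bounded_linear_complex_vec: "bounded_linear (complex_vec :: real^'n \<Rightarrow> complex^'n)"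
  unfolding linear_conv_bounded_linear[symmetric]
  by (rule linearI) (simp_all add: vec_eq_iff complex_vec_def complex_eq_iff)

lemma complex_vec_nth [simp]: "complex_vec v $ i = complex_of_real (v $ i)"
  by (simp add: complex_vec_def)

section \<open>Affine block matrices\<close>

lemma affine_block_nth [simp]:
  "affine_block A x c $ None $ None = c" "affine_block A x c $ None $ Some j = 0"
  "affine_block A x c $ Some i $ None = x $ i" "affine_block A x c $ Some i $ Some j = A $ i $ j"
  by (simp_all add: affine_block_def)

lemma option_matrix_eq_iff:
  fixes M N :: "'a^('n::finite option)^('m::finite option)"
  shows "M = N \<longleftrightarrow> M $ None $ None = N $ None $ None \<and> (\<forall>j. M $ None $ Some j = N $ None $ Some j) \<and>
    (\<forall>i. M $ Some i $ None = N $ Some i $ None) \<and> (\<forall>i j. M $ Some i $ Some j = N $ Some i $ Some j)"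
  unfolding vec_eq_iff split_option_all by auto

lemma sum_UNIV_option: "(\<Sum>s\<in>UNIV. f s) = f None + (\<Sum>j\<in>UNIV. f (Some j))"
  for f :: "'n::finite option \<Rightarrow> 'a::comm_monoid_add"
  unfolding UNIV_option_conv by (subst sum.insert) (auto simp: sum.reindex)

lemma affine_block_mult:
  "affine_block A x c ** affine_block B y d = affine_block (A ** B) (A *v y + d *s x) (c * d)"
  by (simp add: option_matrix_eq_iff matrix_matrix_mult_def matrix_vector_mult_def sum_UNIV_option
      mult.commute add.commute)

lemma affine_block_one: "affine_block (mat 1) 0 1 = mat 1"
  by (simp add: option_matrix_eq_iff mat_def)

lemma affine_block_inject: "affine_block A x c = affine_block B y d \<longleftrightarrow> A = B \<and> x = y \<and> c = d"
  by (auto simp: option_matrix_eq_iff vec_eq_iff)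

lemma affine_block_inverse:
  assumes "A ** B = mat 1"
  shows "affine_block A x 1 ** affine_block B (- (B *v x)) 1 = mat 1"
proof -
  have "A *v - (B *v x) + x = - ((A ** B) *v x) + x"
    unfolding matrix_vector_mul_assoc[symmetric]
    by (simp add: vec_eq_iff matrix_vector_mult_def sum_negf)
  then show ?thesis by (simp add: affine_block_mult assms affine_block_one)
qed

lemma bounded_linear_affine_block:
  "bounded_linear (\<lambda>p. affine_block (fst p) (snd p) 0 :: complex^('n::finite option)^('n option))"
  unfolding linear_conv_bounded_linear[symmetric]
  by (rule linearI) (simp_all add: option_matrix_eq_iff)

lemma has_derivative_affine_block:
  assumes "(E has_derivative E') (at u)" "(X has_derivative X') (at u)"
  shows "((\<lambda>x. affine_block (E x) (X x) 1) has_derivative (\<lambda>v. affine_block (E' v) (X' v) 0)) (at u)"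
proof -
  have "((\<lambda>x. affine_block (E x) (X x) 0 + affine_block 0 0 1) has_derivative
      (\<lambda>v. affine_block (E' v) (X' v) 0 + 0)) (at u)"
    using bounded_linear.has_derivative[OF bounded_linear_affine_block has_derivative_Pair[OF assms]]
    by (intro has_derivative_add has_derivative_const) simp
  moreover have "affine_block A x 0 + affine_block 0 0 1 = affine_block A x 1" for A :: "complex^'b^'b" and x
    by (simp add: option_matrix_eq_iff)
  ultimately show ?thesis by simp
qed

lemma has_derivative_affine_blockD:
  fixes E :: "'a::real_normed_vector \<Rightarrow> complex^'n^'n"
  assumes "((\<lambda>x. affine_block (E x) (X x) c) has_derivative (\<lambda>v. affine_block (E' v) (X' v) c')) (at u)"
  shows "(E has_derivative E') (at u)" "(X has_derivative X') (at u)"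
proof -
  have "bounded_linear (\<lambda>M. (\<chi> i j. M $ Some i $ Some j) :: complex^'n^'n)"
    "bounded_linear (\<lambda>M. (\<chi> i. M $ Some i $ None) :: complex^'n)"
    unfolding linear_conv_bounded_linear[symmetric]
    by (rule linearI, simp_all add: vec_eq_iff)+
  from this[THEN bounded_linear.has_derivative, OF assms]
  show "(E has_derivative E') (at u)" "(X has_derivative X') (at u)" by simp_all
qed

section \<open>The frame equation\<close>

text \<open>The form \<open>\<i>z\<delta> + [\<delta>,\<beta>]\<close>, evaluated on \<open>v\<close>.\<close>

definition lax_matrix :: "real^'n^'n \<Rightarrow> complex \<Rightarrow> real^'n \<Rightarrow> complex^'n^'n" where
  "lax_matrix \<beta> z v = (\<chi> i j. (if i = j then \<i> * z * complex_of_real (v $ i) else 0) +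
     complex_of_real ((v $ i - v $ j) * \<beta> $ i $ j))"

lemma connection_form_eq:
  "connection_form \<beta> h z v = affine_block (lax_matrix \<beta> z v) (complex_vec (\<chi> i. v $ i * h $ i)) 0"
proof -
  have "(diag_matrix v ** \<beta> - \<beta> ** diag_matrix v) $ i $ j = (v $ i - v $ j) * \<beta> $ i $ j" for i j
    by (simp add: diag_matrix_def matrix_matrix_mult_def if_distrib[of "\<lambda>x. x * _"]
        if_distrib[of "\<lambda>x. _ * x"] left_diff_distrib mult.commute[of "\<beta> $ i $ j"] cong: if_cong)
  then have "(\<chi> i j. \<i> * z * complex_mat (diag_matrix v) $ i $ j) +
      complex_mat (diag_matrix v ** \<beta> - \<beta> ** diag_matrix v) = lax_matrix \<beta> z v"
    by (simp add: vec_eq_iff complex_mat_def lax_matrix_def diag_matrix_def)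
  then show ?thesis by (simp add: connection_form_def diag_matrix_mult_vector)
qed

lemma maurer_cartan_eq_iff:
  assumes "invertible (F u)" "F differentiable (at u)"
  shows "(\<forall>v. maurer_cartan F u v = A v) \<longleftrightarrow> (F has_derivative (\<lambda>v. F u ** A v)) (at u)"
proof
  assume "\<forall>v. maurer_cartan F u v = A v"
  then have "F u ** A v = (F u ** matrix_inv (F u)) ** frechet_derivative F (at u) v" for v
    by (simp add: maurer_cartan_def flip: matrix_mul_assoc)
  then have "(\<lambda>v. F u ** A v) = frechet_derivative F (at u)"
    by (simp add: fun_eq_iff matrix_inv_right[OF assms(1)])
  then show "(F has_derivative (\<lambda>v. F u ** A v)) (at u)"
    using assms(2) by (simp flip: frechet_derivative_works)
next
  assume "(F has_derivative (\<lambda>v. F u ** A v)) (at u)"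
  from frechet_derivative_at[OF this]
  have "frechet_derivative F (at u) = (\<lambda>v. F u ** A v)" by simp
  then have "maurer_cartan F u v = (matrix_inv (F u) ** F u) ** A v" for v
    by (simp add: maurer_cartan_def matrix_mul_assoc)
  then show "\<forall>v. maurer_cartan F u v = A v" by (simp add: matrix_inv_left[OF assms(1)])
qed

lemma frame_equation_on_affine_blockD:
  assumes "frame_equation_on U \<beta> h (\<lambda>u z. affine_block (E u z) (X u z) 1)" "u \<in> U"
  shows "((\<lambda>x. E x z) has_derivative (\<lambda>v. E u z ** lax_matrix (\<beta> u) z v)) (at u)"
    and "((\<lambda>x. X x z) has_derivative (\<lambda>v. E u z *v complex_vec (\<chi> i. v $ i * h u $ i))) (at u)"
    and "(\<lambda>z. E u z $ i $ j) holomorphic_on UNIV"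
    and "(\<lambda>z. X u z $ i) holomorphic_on UNIV"
proof -
  let ?F = "\<lambda>x. affine_block (E x z) (X x z) 1"
  have F: "entrywise_holomorphic_on (\<lambda>z. affine_block (E u z) (X u z) 1) UNIV"
    "invertible (?F u)" "?F differentiable (at u)"
    "\<forall>v. maurer_cartan ?F u v = connection_form (\<beta> u) (h u) z v"
    using assms unfolding frame_equation_on_def by blast+
  from maurer_cartan_eq_iff[THEN iffD1, OF F(2-4)]
  have "(?F has_derivative (\<lambda>v. affine_block (E u z ** lax_matrix (\<beta> u) z v)
      (E u z *v complex_vec (\<chi> i. v $ i * h u $ i)) 0)) (at u)"
    by (simp add: connection_form_eq affine_block_mult)
  from has_derivative_affine_blockD[OF this]
  show "((\<lambda>x. E x z) has_derivative (\<lambda>v. E u z ** lax_matrix (\<beta> u) z v)) (at u)"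
    and "((\<lambda>x. X x z) has_derivative (\<lambda>v. E u z *v complex_vec (\<chi> i. v $ i * h u $ i))) (at u)"
    by simp_all
  have "(\<lambda>z. affine_block (E u z) (X u z) 1 $ r $ s) holomorphic_on UNIV" for r s
    using F(1) unfolding entrywise_holomorphic_on_def by blast
  from this[of "Some i" "Some j"] this[of "Some i" None]
  show "(\<lambda>z. E u z $ i $ j) holomorphic_on UNIV" "(\<lambda>z. X u z $ i) holomorphic_on UNIV" by simp_all
qed

lemma frame_equation_on_affine_blockI:
  assumes hol: "\<And>u i j. u \<in> U \<Longrightarrow> (\<lambda>z. E u z $ i $ j) holomorphic_on UNIV"
      "\<And>u i. u \<in> U \<Longrightarrow> (\<lambda>z. X u z $ i) holomorphic_on UNIV"
    and inv: "\<And>u z. u \<in> U \<Longrightarrow> invertible (affine_block (E u z) (X u z) 1)"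
    and deriv: "\<And>u z. u \<in> U \<Longrightarrow> ((\<lambda>x. E x z) has_derivative (\<lambda>v. E u z ** lax_matrix (\<beta> u) z v)) (at u)"
      "\<And>u z. u \<in> U \<Longrightarrow>
        ((\<lambda>x. X x z) has_derivative (\<lambda>v. E u z *v complex_vec (\<chi> i. v $ i * h u $ i))) (at u)"
  shows "frame_equation_on U \<beta> h (\<lambda>u z. affine_block (E u z) (X u z) 1)"
  unfolding frame_equation_on_def
proof (intro ballI conjI allI)
  fix u z assume u: "u \<in> U"
  let ?F = "\<lambda>x. affine_block (E x z) (X x z) 1"
  show "entrywise_holomorphic_on (\<lambda>z. affine_block (E u z) (X u z) 1) UNIV"
    unfolding entrywise_holomorphic_on_def split_option_all by (simp add: hol[OF u])
  show "invertible (?F u)" by (rule inv[OF u])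
  have F: "(?F has_derivative (\<lambda>v. ?F u ** connection_form (\<beta> u) (h u) z v)) (at u)"
    using has_derivative_affine_block[OF deriv[OF u]]
    by (simp add: connection_form_eq affine_block_mult)
  then show dif: "?F differentiable (at u)" by (rule differentiableI)
  show "maurer_cartan ?F u v = connection_form (\<beta> u) (h u) z v" for v
    using maurer_cartan_eq_iff[THEN iffD2, OF inv[OF u] dif F] by blast
qed

section \<open>Symmetries and regularity of frames\<close>

lemma transpose_lax_matrix:
  assumes "transpose \<beta> = \<beta>"
  shows "transpose (lax_matrix \<beta> z v) = - lax_matrix \<beta> (- z) v"
proof -
  have "\<beta> $ j $ i = \<beta> $ i $ j" for i j
    using arg_cong[OF assms, of "\<lambda>M. M $ i $ j"] by (simp add: transpose_def)
  then show ?thesis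
    by (auto simp: vec_eq_iff transpose_def lax_matrix_def algebra_simps)
qed

lemma cnj_mat_lax_matrix: "cnj_mat (lax_matrix \<beta> (- cnj z) v) = lax_matrix \<beta> z v"
  by (simp add: vec_eq_iff cnj_mat_def lax_matrix_def)

lemma matrix_mult_uminus: "A ** (- B) = - (A ** B)" "(- A) ** B = - (A ** B)"
  for A B :: "complex^'n^'n"
  by (simp_all add: vec_eq_iff matrix_matrix_mult_def sum_negf)

text \<open>\<open>d(M N\<^sup>t) = M (A + B\<^sup>t) N\<^sup>t\<close> when \<open>dM = M A\<close> and \<open>dN = N B\<close>.\<close>

lemma frame_product_constant:
  fixes M N :: "'a::real_normed_vector \<Rightarrow> complex^'n^'n"
  assumes "open U" "connected U" "u \<in> U" "w \<in> U"
    and M: "\<And>u. u \<in> U \<Longrightarrow> (M has_derivative (\<lambda>v. M u ** A u v)) (at u)"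
    and N: "\<And>u. u \<in> U \<Longrightarrow> (N has_derivative (\<lambda>v. N u ** B u v)) (at u)"
    and AB: "\<And>u v. u \<in> U \<Longrightarrow> transpose (B u v) = - A u v"
  shows "M u ** transpose (N u) = M w ** transpose (N w)"
proof (rule has_derivative_zero_unique_connected[OF assms(1,2) _ assms(3,4)])
  fix u assume u: "u \<in> U"
  have "M u ** transpose (N u ** B u v) + (M u ** A u v) ** transpose (N u) = 0" for v
    by (simp add: matrix_transpose_mul AB[OF u] matrix_mult_uminus matrix_mul_assoc)
  then show "((\<lambda>u. M u ** transpose (N u)) has_derivative (\<lambda>v. 0)) (at u)"
    using bounded_bilinear.FDERIV[OF bounded_bilinear_matrix_mult M[OF u]
        bounded_linear.has_derivative[OF bounded_linear_transpose N[OF u]]] by simp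
qed

text \<open>The data of an extended frame together with the symmetries that follow from the normalisation
  at one point. The symmetries are part of the locale because they hold for the dressed data too:
  dressing changes neither \<open>E\<close> nor \<open>\<beta>\<close>. The entries of \<open>h\<close> may vanish, as those of the dressed \<open>h\<close> sometimes do.\<close>

locale egoroff_frame =
  fixes U :: "(real^'n) set" and \<beta> :: "real^'n \<Rightarrow> real^'n^'n" and h :: "real^'n \<Rightarrow> real^'n"
    and E :: "real^'n \<Rightarrow> complex \<Rightarrow> complex^'n^'n" and X :: "real^'n \<Rightarrow> complex \<Rightarrow> complex^'n"
  assumes open_U: "open U"
    and smooth_\<beta>: "smooth_on U \<beta>" and sym_\<beta>: "u \<in> U \<Longrightarrow> transpose (\<beta> u) = \<beta> u"
    and smooth_h: "smooth_on U h"
    and E_deriv: "u \<in> U \<Longrightarrow> ((\<lambda>x. E x z) has_derivative (\<lambda>v. E u z ** lax_matrix (\<beta> u) z v)) (at u)"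
    and X_deriv: "u \<in> U \<Longrightarrow>
      ((\<lambda>x. X x z) has_derivative (\<lambda>v. E u z *v complex_vec (\<chi> i. v $ i * h u $ i))) (at u)"
    and E_hol: "u \<in> U \<Longrightarrow> (\<lambda>z. E u z $ i $ j) holomorphic_on UNIV"
    and X_hol: "u \<in> U \<Longrightarrow> (\<lambda>z. X u z $ i) holomorphic_on UNIV"
    and E_transpose: "u \<in> U \<Longrightarrow> E u z ** transpose (E u (- z)) = mat 1"
    and E_cnj: "u \<in> U \<Longrightarrow> cnj_mat (E u (- cnj z)) = E u z"

text \<open>Both symmetries come from products that are constant on the connected set \<open>U\<close>: \<open>E(z) E(-z)\<^sup>t\<close>, and
  \<open>C(z) E(-z)\<^sup>t\<close> where \<open>C(z)\<close> is the conjugate of \<open>E\<close> at minus the conjugate of \<open>z\<close>. The two products being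
  equal, \<open>C = E\<close>.\<close>

lemma egoroff_frameI:
  assumes "open U" "connected U" "w \<in> U" and \<beta>: "smooth_on U \<beta>" "\<And>u. u \<in> U \<Longrightarrow> transpose (\<beta> u) = \<beta> u"
    and h: "smooth_on U h"
    and frame: "frame_equation_on U \<beta> h (\<lambda>u z. affine_block (E u z) (X u z) 1)"
    and initial: "\<And>z. E w z = mat 1"
  shows "egoroff_frame U \<beta> h E X"
proof -
  note D = frame_equation_on_affine_blockD[OF frame]
  have skew: "transpose (lax_matrix (\<beta> u) (- z) v) = - lax_matrix (\<beta> u) z v" if "u \<in> U" for u z v
    using transpose_lax_matrix[OF \<beta>(2)[OF that], of "- z"] by simp
  have E: "E u z ** transpose (E u (- z)) = mat 1" if "u \<in> U" for u z
    using frame_product_constant[OF assms(1,2) that assms(3) D(1) D(1) skew] by (simp add: initial)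
  have cnj: "cnj_mat (E u (- cnj z)) ** transpose (E u (- z)) = mat 1" if "u \<in> U" for u z
  proof -
    have deriv: "((\<lambda>x. cnj_mat (E x (- cnj z))) has_derivative
        (\<lambda>v. cnj_mat (E u (- cnj z)) ** lax_matrix (\<beta> u) z v)) (at u)" if "u \<in> U" for u
      using bounded_linear.has_derivative[OF bounded_linear_cnj_mat D(1)[OF that, of "- cnj z"]]
      by (simp add: cnj_mat_mult cnj_mat_lax_matrix)
    have "cnj_mat (mat 1) = mat 1" by (simp add: vec_eq_iff cnj_mat_def mat_def)
    then show ?thesis
      using frame_product_constant[OF assms(1,2) that assms(3) deriv D(1) skew] by (simp add: initial)
  qed
  have "cnj_mat (E u (- cnj z)) = E u z" if "u \<in> U" for u z
  proof -
    have "transpose (E u (- z)) ** E u z = mat 1"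
      by (rule iffD1[OF matrix_left_right_inverse E[OF that]])
    then have "cnj_mat (E u (- cnj z)) = cnj_mat (E u (- cnj z)) ** transpose (E u (- z)) ** E u z"
      by (simp flip: matrix_mul_assoc)
    then show ?thesis by (simp add: cnj[OF that])
  qed
  then show ?thesis
    using assms(1) \<beta> h D E by unfold_locales auto
qed

context egoroff_frame
begin

lemma E_transpose': "u \<in> U \<Longrightarrow> transpose (E u (- z)) ** E u z = mat 1"
  by (rule iffD1[OF matrix_left_right_inverse E_transpose])

lemma matrix_inv_E: "u \<in> U \<Longrightarrow> matrix_inv (E u z) = transpose (E u (- z))"
  by (rule matrix_inv_eqI[OF E_transpose])

lemma E_tendsto:
  assumes "u \<in> U" "(\<zeta> \<longlongrightarrow> z) F"
  shows "((\<lambda>k. E u (\<zeta> k)) \<longlongrightarrow> E u z) F"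
proof (intro vec_tendstoI)
  fix i j
  have "isCont (\<lambda>z. E u z $ i $ j) z"
    using holomorphic_on_imp_continuous_on[OF E_hol[OF assms(1)]] continuous_on_eq_continuous_at by blast
  then show "((\<lambda>k. E u (\<zeta> k) $ i $ j) \<longlongrightarrow> E u z $ i $ j) F"
    by (rule isCont_tendsto_compose) (rule assms(2))
qed

lemma smooth_lax_matrix: "smooth_on U (\<lambda>u. lax_matrix (\<beta> u) z v)"
proof -
  have "smooth_on U (\<lambda>u. \<beta> u $ i $ j)" for i j
    using smooth_\<beta> by (simp add: smooth_on_vec_iff[OF open_U])
  then have "smooth_on U (\<lambda>u. c + complex_of_real ((v $ i - v $ j) * \<beta> u $ i $ j))" for i j c
    by (intro smooth_on_add smooth_on_const open_U smooth_on_bounded_linear[OF open_U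
          bounded_linear_compose[OF bounded_linear_of_real bounded_linear_mult_right]])
  then show ?thesis
    by (simp add: smooth_on_vec_iff[OF open_U] lax_matrix_def)
qed

text \<open>Bootstrapping in \<open>dE = E A\<close>.\<close>

lemma smooth_E: "smooth_on U (\<lambda>u. E u z)"
proof -
  have "Ck_on k U (\<lambda>u. E u z)" for k
  proof (induction k)
    case 0
    show ?case
      using E_deriv[THEN differentiableI]
      by (auto intro!: continuous_at_imp_continuous_on differentiable_imp_continuous_within)
  next
    case (Suc k)
    show ?case
    proof (rule Ck_on_SucI[OF open_U E_deriv])
      show "Ck_on k U (\<lambda>u. E u z ** lax_matrix (\<beta> u) z v)" for v
        using smooth_lax_matrix[of z v] unfolding smooth_on_def
        by (intro Ck_on_bilinear[OF open_U bounded_bilinear_matrix_mult Suc.IH]) simp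
    qed
  qed
  then show ?thesis by (simp add: smooth_on_def)
qed

lemma smooth_E_apply:
  assumes "V \<subseteq> U" "open V" "smooth_on V w"
  shows "smooth_on V (\<lambda>u. E u z *v complex_vec (w u))"
  by (intro smooth_on_bilinear[OF assms(2) bounded_bilinear_matrix_vector_mult]
      smooth_on_bounded_linear[OF assms(2) bounded_linear_complex_vec] assms(3)
      smooth_on_subset[OF smooth_E assms(1)])

lemma smooth_scaled_h: "smooth_on U (\<lambda>u. \<chi> i. v $ i * h u $ i)"
  using smooth_h
  by (auto simp: smooth_on_vec_iff[OF open_U]
      intro: smooth_on_bounded_linear[OF open_U bounded_linear_mult_right])

lemma smooth_X: "smooth_on U (\<lambda>u. X u z)"
  by (rule smooth_on_derivI[OF open_U X_deriv]) (auto intro: smooth_E_apply smooth_scaled_h open_U)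

text \<open>With \<open>D\<^sub>k = E(\<cdot>,\<zeta>\<^sub>k) E(\<cdot>,z)\<^sup>-\<^sup>1\<close> one has \<open>dD\<^sub>k = D\<^sub>k P\<close> where \<open>P\<close> is \<open>\<zeta>\<^sub>k - z\<close> times a form independent
  of \<open>k\<close>. The mean value inequality therefore bounds \<open>D\<^sub>k\<close> first and then \<open>D\<^sub>k - I\<close>.\<close>

lemma uniform_limit_E:
  assumes ball: "cball u\<^sub>0 r \<subseteq> U" "r > 0" and \<zeta>: "\<zeta> \<longlonglongrightarrow> z"
  shows "uniform_limit (cball u\<^sub>0 r) (\<lambda>k u. E u (\<zeta> k)) (\<lambda>u. E u z) sequentially"
proof -
  define S where "S = cball u\<^sub>0 r"
  have S: "compact S" "convex S" "u\<^sub>0 \<in> S" "S \<noteq> {}" "\<And>u. u \<in> S \<Longrightarrow> u \<in> U"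
    using ball by (auto simp: S_def)
  define T where "T u = transpose (E u (- z))" for u
  define D where "D k u = E u (\<zeta> k) ** T u" for k u
  define \<Delta> where "\<Delta> k u v = lax_matrix (\<beta> u) (\<zeta> k) v - lax_matrix (\<beta> u) z v" for k u v
  obtain K where K: "K > 0" "\<And>(A::complex^'n^'n) (B::complex^'n^'n). norm (A ** B) \<le> norm A * norm B * K"
    using bounded_bilinear.pos_bounded[OF bounded_bilinear_matrix_mult] by blast
  have mult_le: "norm (A ** B) \<le> a * b * K" if "norm A \<le> a" "norm B \<le> b" for A B :: "complex^'n^'n" and a b
  proof -
    have "norm A * norm B \<le> a * b"
      by (rule mult_mono'[OF that]) simp_all
    then have "norm A * norm B * K \<le> a * b * K" using K(1) by (simp add: mult_right_mono)
    then show ?thesis by (rule order_trans[OF K(2)])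
  qed
  have cont: "continuous_on S (\<lambda>u. E u w)" for w
    using smooth_on_imp_continuous_on[OF smooth_E] S(5) continuous_on_subset by blast
  have bounded: "\<exists>B>0. \<forall>u\<in>S. norm (f u) \<le> B" if "continuous_on S f" for f :: "real^'n \<Rightarrow> complex^'n^'n"
    using compact_imp_bounded[OF compact_continuous_image[OF that S(1)]] unfolding bounded_pos by auto
  have contT: "continuous_on S T"
    unfolding T_def by (rule bounded_linear.continuous_on[OF bounded_linear_transpose cont])
  obtain B where B: "B > 0" "\<And>u. u \<in> S \<Longrightarrow> norm (E u z) \<le> B" using bounded[OF cont] by blast
  obtain B' where B': "B' > 0" "\<And>u. u \<in> S \<Longrightarrow> norm (T u) \<le> B'" using bounded[OF contT] by blast
  define C where "C = K * (B * (real CARD('n)) * K * B' * K)"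
  have C: "C > 0" unfolding C_def using K B B' by simp

  have \<Delta>_bound: "norm (\<Delta> k u v) \<le> real CARD('n) * (norm (\<zeta> k - z) * norm v)" for k u v
  proof -
    have row: "norm (\<Delta> k u v $ i) \<le> norm (\<zeta> k - z) * norm v" for i
    proof -
      have "\<Delta> k u v $ i = axis i (\<i> * (\<zeta> k - z) * complex_of_real (v $ i))"
        by (simp add: \<Delta>_def lax_matrix_def vec_eq_iff axis_def algebra_simps)
      then have "norm (\<Delta> k u v $ i) \<le> norm (\<zeta> k - z) * \<bar>v $ i\<bar>"
        using norm_axis_le[of i "\<i> * (\<zeta> k - z) * complex_of_real (v $ i)"] by (simp add: norm_mult)
      also have "\<dots> \<le> norm (\<zeta> k - z) * norm v"
        using component_le_norm_cart[of v i] by (simp add: mult_left_mono)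
      finally show ?thesis .
    qed
    have "norm (\<Delta> k u v) \<le> (\<Sum>i\<in>(UNIV::'n set). norm (\<Delta> k u v $ i))"
      unfolding norm_vec_def[of "\<Delta> k u v"] by (rule L2_set_le_sum) simp
    also have "\<dots> \<le> real CARD('n) * (norm (\<zeta> k - z) * norm v)"
      using sum_bounded_above[of UNIV "\<lambda>i. norm (\<Delta> k u v $ i)", OF row] by simp
    finally show ?thesis .
  qed
  have factor: "E u (\<zeta> k) = D k u ** E u z" if "u \<in> S" for k u
    using E_transpose'[OF S(5)[OF that]] by (simp add: D_def T_def flip: matrix_mul_assoc)
  have D_deriv: "(D k has_derivative (\<lambda>v. D k u ** ((E u z ** \<Delta> k u v) ** T u))) (at u)" if "u \<in> S" for k u
  proof -
    note u = S(5)[OF that]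
    have "transpose (E u (- z) ** lax_matrix (\<beta> u) (- z) v) = - lax_matrix (\<beta> u) z v ** T u" for v
      using transpose_lax_matrix[OF sym_\<beta>[OF u], of "- z"] by (simp add: matrix_transpose_mul T_def)
    then have "E u (\<zeta> k) ** transpose (E u (- z) ** lax_matrix (\<beta> u) (- z) v) +
        (E u (\<zeta> k) ** lax_matrix (\<beta> u) (\<zeta> k) v) ** T u = (E u (\<zeta> k) ** \<Delta> k u v) ** T u" for v
      by (simp add: \<Delta>_def bounded_bilinear.diff_right[OF bounded_bilinear_matrix_mult]
          bounded_bilinear.diff_left[OF bounded_bilinear_matrix_mult] matrix_mul_assoc matrix_mult_uminus)
    also have "(E u (\<zeta> k) ** \<Delta> k u v) ** T u = D k u ** ((E u z ** \<Delta> k u v) ** T u)" for v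
      unfolding factor[OF that] by (simp add: matrix_mul_assoc)
    finally show ?thesis
      unfolding D_def[abs_def] T_def
      using bounded_bilinear.FDERIV[OF bounded_bilinear_matrix_mult E_deriv[OF u]
          bounded_linear.has_derivative[OF bounded_linear_transpose E_deriv[OF u]], of "\<zeta> k" "- z"]
      by simp
  qed
  have D_deriv_bound: "norm (D k u ** ((E u z ** \<Delta> k u v) ** T u)) \<le> (M * C * norm (\<zeta> k - z)) * norm v"
    if "u \<in> S" "norm (D k u) \<le> M" for k u v M
  proof -
    have "norm (E u z ** \<Delta> k u v) \<le> B * (real CARD('n) * (norm (\<zeta> k - z) * norm v)) * K"
      by (rule mult_le[OF B(2)[OF that(1)] \<Delta>_bound])
    then have "norm ((E u z ** \<Delta> k u v) ** T u) \<le>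
        (B * (real CARD('n) * (norm (\<zeta> k - z) * norm v)) * K) * B' * K"
      by (rule mult_le[OF _ B'(2)[OF that(1)]])
    then have "norm (D k u ** ((E u z ** \<Delta> k u v) ** T u)) \<le>
        M * ((B * (real CARD('n) * (norm (\<zeta> k - z) * norm v)) * K) * B' * K) * K"
      by (rule mult_le[OF that(2)])
    then show ?thesis by (simp add: C_def mult_ac)
  qed
  have D_close: "norm (D k u - D k u\<^sub>0) \<le> M * C * norm (\<zeta> k - z) * r"
    if "u \<in> S" "\<And>u. u \<in> S \<Longrightarrow> norm (D k u) \<le> M" for k u M
  proof -
    have "M \<ge> 0" using that norm_ge_zero order_trans by blast
    have "norm (D k u - D k u\<^sub>0) \<le> (M * C * norm (\<zeta> k - z)) * norm (u - u\<^sub>0)"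
      by (rule differentiable_bound[OF S(2) has_derivative_at_withinI[OF D_deriv] onorm_le[OF D_deriv_bound]])
        (use that S in auto)
    also have "\<dots> \<le> (M * C * norm (\<zeta> k - z)) * r"
      using that(1) C \<open>M \<ge> 0\<close> by (intro mult_left_mono) (auto simp: S_def dist_norm norm_minus_commute)
    finally show ?thesis .
  qed

  define N where "N = norm (mat 1 :: complex^'n^'n) + 1"
  have D0: "(\<lambda>k. D k u\<^sub>0) \<longlonglongrightarrow> mat 1"
    unfolding D_def T_def E_transpose[OF S(5)[OF S(3)], symmetric, of z]
    by (intro bounded_bilinear.tendsto[OF bounded_bilinear_matrix_mult] E_tendsto[OF S(5)[OF S(3)] \<zeta>] tendsto_const)
  have \<zeta>0: "(\<lambda>k. norm (\<zeta> k - z)) \<longlonglongrightarrow> 0"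
    using \<zeta> by (simp add: LIM_zero tendsto_norm_zero)
  have ev1: "\<forall>\<^sub>F k in sequentially. norm (D k u\<^sub>0) < N"
    using tendsto_norm[OF D0] by (rule order_tendstoD) (simp add: N_def)
  have "(\<lambda>k. C * norm (\<zeta> k - z) * r) \<longlonglongrightarrow> C * 0 * r"
    by (intro tendsto_intros \<zeta>0)
  then have ev2: "\<forall>\<^sub>F k in sequentially. C * norm (\<zeta> k - z) * r < 1 / 2"
    by (rule order_tendstoD) simp
  define \<epsilon> where "\<epsilon> k = (2 * N * C * norm (\<zeta> k - z) * r + norm (D k u\<^sub>0 - mat 1)) * B * K" for k
  have ev: "\<forall>\<^sub>F k in sequentially. \<forall>u\<in>S. norm (E u (\<zeta> k) - E u z) \<le> \<epsilon> k"
    using ev1 ev2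
  proof eventually_elim
    case (elim k)
    \<comment> \<open>the bound \<open>M\<close> in \<open>D_close\<close> is the maximum of the norm of \<open>D\<^sub>k\<close> itself, which is absorbed on the left\<close>
    have "continuous_on S (\<lambda>u. norm (D k u))"
      unfolding D_def by (intro continuous_on_norm bounded_bilinear.continuous_on[OF bounded_bilinear_matrix_mult] cont contT)
    then obtain m where m: "m \<in> S" "\<And>u. u \<in> S \<Longrightarrow> norm (D k u) \<le> norm (D k m)"
      using continuous_attains_sup[OF S(1,4)] by blast
    have "norm (D k m) \<le> norm (D k u\<^sub>0) + norm (D k m - D k u\<^sub>0)"
      using norm_triangle_ineq[of "D k u\<^sub>0" "D k m - D k u\<^sub>0"] by simp
    also have "norm (D k m - D k u\<^sub>0) \<le> norm (D k m) * (C * norm (\<zeta> k - z) * r)"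
      using D_close[OF m] by (simp add: mult.assoc)
    also have "\<dots> \<le> norm (D k m) * (1 / 2)"
      using elim by (intro mult_left_mono) auto
    finally have "norm (D k m) \<le> 2 * N" using elim by simp
    then have "norm (D k u) \<le> 2 * N" if "u \<in> S" for u using m(2)[OF that] by simp
    then have "norm (D k u - D k u\<^sub>0) \<le> 2 * N * C * norm (\<zeta> k - z) * r" if "u \<in> S" for u
      using D_close[OF that] by blast
    then have I: "norm (D k u - mat 1) \<le> 2 * N * C * norm (\<zeta> k - z) * r + norm (D k u\<^sub>0 - mat 1)" if "u \<in> S" for u
      using norm_triangle_ineq[of "D k u - D k u\<^sub>0" "D k u\<^sub>0 - mat 1"] that by (smt (verit) diff_add_cancel add_diff_eq)
    show ?case
    proof
      fix u assume u: "u \<in> S"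
      have "E u (\<zeta> k) - E u z = (D k u - mat 1) ** E u z"
        by (simp add: factor[OF u] bounded_bilinear.diff_left[OF bounded_bilinear_matrix_mult])
      then show "norm (E u (\<zeta> k) - E u z) \<le> \<epsilon> k"
        unfolding \<epsilon>_def using mult_le[OF I[OF u] B(2)[OF u]] by simp
    qed
  qed
  have "\<epsilon> \<longlonglongrightarrow> (2 * N * C * 0 * r + 0) * B * K"
    unfolding \<epsilon>_def[abs_def]
    by (intro tendsto_intros \<zeta>0 tendsto_norm_zero LIM_zero D0)
  then have \<epsilon>: "\<epsilon> \<longlonglongrightarrow> 0" by simp
  show ?thesis
    unfolding uniform_limit_iff S_def[symmetric]
  proof (intro allI impI)
    fix e :: real assume "e > 0"
    then have "\<forall>\<^sub>F k in sequentially. \<epsilon> k < e" using \<epsilon> by (rule order_tendstoD(2)[rotated])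
    with ev show "\<forall>\<^sub>F k in sequentially. \<forall>u\<in>S. dist (E u (\<zeta> k)) (E u z) < e"
      by eventually_elim (auto simp: dist_norm intro: le_less_trans)
  qed
qed

end

section \<open>Dressing by a simple element\<close>

lemma bounded_linear_vector_scalar_mult: "bounded_linear (\<lambda>x::complex^'n. c *s x)"
  unfolding linear_conv_bounded_linear[symmetric]
  by (rule linearI) (simp_all add: vec_eq_iff algebra_simps)

lemma bounded_linear_matrix_vector_mult: "bounded_linear (\<lambda>x::complex^'n. A *v x)"
  by (rule bounded_bilinear.bounded_linear_right[OF bounded_bilinear_matrix_vector_mult])

lemma lax_matrix_diff:
  "lax_matrix \<beta> z v - lax_matrix \<beta> w v = diag_matrix (\<chi> i. \<i> * (z - w) * complex_of_real (v $ i))"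
  by (simp add: vec_eq_iff lax_matrix_def diag_matrix_def algebra_simps)

context egoroff_frame
begin

context
  fixes \<alpha> :: real and b :: "real^'n"
begin

text \<open>The vector \<open>g = E(\<cdot>,\<i>\<alpha>)\<^sup>-\<^sup>1 b\<close>. The inverse is written as the transpose of \<open>E(\<cdot>,-\<i>\<alpha>)\<close>, which makes
  \<open>g\<close> linear in the frame; the real part discards nothing on \<open>U\<close>, where
  \<open>E(\<cdot>,-\<i>\<alpha>)\<close> is real.\<close>

definition dress_vec :: "real^'n \<Rightarrow> real^'n" where
  "dress_vec u = (\<chi> i. Re ((transpose (E u (- (\<i> * \<alpha>))) *v complex_vec b) $ i))"

definition dress_h :: "real^'n \<Rightarrow> real^'n" where
  "dress_h u = h u + dress_vec u"

definition dress_residue :: "real^'n \<Rightarrow> complex \<Rightarrow> complex^'n" where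
  "dress_residue u z = complex_vec b - E u z *v complex_vec (dress_vec u)"

text \<open>At the pole the difference quotient is replaced by its limit. Subtracting the value of the
  residue at the pole, which is zero on \<open>U\<close>, makes the quotient entire by construction.\<close>

definition dress_X :: "real^'n \<Rightarrow> complex \<Rightarrow> complex^'n" where
  "dress_X u z = X u z + (\<chi> i. \<i> * (if z = \<i> * \<alpha> then deriv (\<lambda>z. dress_residue u z $ i) (\<i> * \<alpha>)
      else (dress_residue u z $ i - dress_residue u (\<i> * \<alpha>) $ i) / (z - \<i> * \<alpha>)))"

text \<open>The matrix \<open>E(\<cdot>,-\<i>\<alpha>)\<close> is real because \<open>-\<i>\<alpha>\<close> is fixed under \<open>z \<mapsto> - cnj z\<close>.\<close>

lemma complex_vec_dress_vec':
  assumes "u \<in> U"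
  shows "complex_vec (dress_vec u) = transpose (E u (- (\<i> * \<alpha>))) *v complex_vec b"
proof -
  have "cnj (E u (- (\<i> * \<alpha>)) $ j $ i) = E u (- (\<i> * \<alpha>)) $ j $ i" for i j
    using arg_cong[OF E_cnj[OF assms, of "- (\<i> * \<alpha>)"], of "\<lambda>M. M $ j $ i"] by (simp add: cnj_mat_def)
  then have "cnj ((transpose (E u (- (\<i> * \<alpha>))) *v complex_vec b) $ i) =
      (transpose (E u (- (\<i> * \<alpha>))) *v complex_vec b) $ i" for i
    unfolding matrix_vector_mult_def transpose_def by simp
  then show ?thesis
    unfolding vec_eq_iff complex_vec_nth dress_vec_def vec_lambda_beta
    by (metis Reals_cnj_iff of_real_Re)
qed

lemma complex_vec_dress_vec:
  "u \<in> U \<Longrightarrow> complex_vec (dress_vec u) = matrix_inv (E u (\<i> * \<alpha>)) *v complex_vec b"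
  by (simp only: complex_vec_dress_vec' matrix_inv_E)

lemma dress_residue_pole:
  assumes "u \<in> U" shows "dress_residue u (\<i> * \<alpha>) = 0"
proof -
  have "E u (\<i> * \<alpha>) *v complex_vec (dress_vec u) = (E u (\<i> * \<alpha>) ** transpose (E u (- (\<i> * \<alpha>)))) *v complex_vec b"
    by (simp only: complex_vec_dress_vec'[OF assms] matrix_vector_mul_assoc)
  then show ?thesis by (simp add: dress_residue_def E_transpose[OF assms])
qed

lemma dress_X_off_pole:
  assumes "u \<in> U" "z \<noteq> \<i> * \<alpha>"
  shows "dress_X u z = X u z + (\<i> / (z - \<i> * \<alpha>)) *s dress_residue u z"
  using assms by (simp add: dress_X_def dress_residue_pole vec_eq_iff)

lemma dress_residue_holomorphic:
  assumes "u \<in> U"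
  shows "(\<lambda>z. dress_residue u z $ i) holomorphic_on UNIV"
  unfolding dress_residue_def matrix_vector_mult_def
  by (simp, intro holomorphic_intros E_hol[OF assms])

lemma dress_X_holomorphic:
  assumes "u \<in> U"
  shows "(\<lambda>z. dress_X u z $ i) holomorphic_on UNIV"
  unfolding dress_X_def
  by (simp only: vector_add_component vec_lambda_beta,
      intro holomorphic_intros X_hol[OF assms] pole_lemma_open[OF dress_residue_holomorphic[OF assms]])
    simp

text \<open>\<open>d(E(-\<i>\<alpha>)\<^sup>t b) = A(-\<i>\<alpha>)\<^sup>t E(-\<i>\<alpha>)\<^sup>t b\<close>, and \<open>A(-\<i>\<alpha>)\<^sup>t = - A(\<i>\<alpha>)\<close>.\<close>

lemma dress_vec_complex_deriv:
  assumes u: "u \<in> U"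
  shows "((\<lambda>x. complex_vec (dress_vec x)) has_derivative
    (\<lambda>v. - (lax_matrix (\<beta> u) (\<i> * \<alpha>) v *v complex_vec (dress_vec u)))) (at u)"
proof -
  let ?T = "transpose (E u (- (\<i> * \<alpha>)))"
  have "transpose (lax_matrix (\<beta> u) (- (\<i> * \<alpha>)) v) = - lax_matrix (\<beta> u) (\<i> * \<alpha>) v" for v
    using transpose_lax_matrix[OF sym_\<beta>[OF u], of "- (\<i> * \<alpha>)"] by simp
  then have eq: "transpose (E u (- (\<i> * \<alpha>)) ** lax_matrix (\<beta> u) (- (\<i> * \<alpha>)) v) *v complex_vec b =
      - (lax_matrix (\<beta> u) (\<i> * \<alpha>) v *v complex_vec (dress_vec u))" for v
    unfolding matrix_transpose_mul complex_vec_dress_vec'[OF u] matrix_vector_mul_assoc[symmetric]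
    by (simp only: bounded_bilinear.minus_left[OF bounded_bilinear_matrix_vector_mult])
  have "((\<lambda>x. transpose (E x (- (\<i> * \<alpha>))) *v complex_vec b) has_derivative
      (\<lambda>v. transpose (E u (- (\<i> * \<alpha>)) ** lax_matrix (\<beta> u) (- (\<i> * \<alpha>)) v) *v complex_vec b)) (at u)"
    by (rule bounded_linear.has_derivative[OF bounded_bilinear.bounded_linear_left[OF
            bounded_bilinear_matrix_vector_mult] bounded_linear.has_derivative[OF bounded_linear_transpose E_deriv[OF u]]])
  then show ?thesis
    unfolding eq
    by (rule has_derivative_transform_within_open[OF _ open_U u]) (simp only: complex_vec_dress_vec')
qed

lemma dress_vec_deriv:
  assumes u: "u \<in> U"
  shows "(dress_vec has_derivative (\<lambda>v. \<chi> i. \<alpha> * v $ i * dress_vec u $ i -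
    (\<Sum>k\<in>UNIV. (v $ i - v $ k) * \<beta> u $ i $ k * dress_vec u $ k))) (at u)"
proof -
  have "bounded_linear (\<lambda>x. (\<chi> i. Re (x $ i)) :: real^'n)"
    unfolding linear_conv_bounded_linear[symmetric]
    by (rule linearI) (simp_all add: vec_eq_iff)
  from bounded_linear.has_derivative[OF this dress_vec_complex_deriv[OF u]]
  have "(dress_vec has_derivative (\<lambda>v. \<chi> i. Re ((- (lax_matrix (\<beta> u) (\<i> * \<alpha>) v *v complex_vec (dress_vec u))) $ i))) (at u)"
    by simp
  moreover have "(\<chi> i. Re ((- (lax_matrix (\<beta> u) (\<i> * \<alpha>) v *v complex_vec (dress_vec u))) $ i)) =
     (\<chi> i. \<alpha> * v $ i * dress_vec u $ i - (\<Sum>k\<in>UNIV. (v $ i - v $ k) * \<beta> u $ i $ k * dress_vec u $ k))" for v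
    by (simp add: vec_eq_iff lax_matrix_def matrix_vector_mult_def distrib_right sum.distrib
        if_distrib[of "\<lambda>x. x * _"] if_distrib[of Re] cong: if_cong)
  ultimately show ?thesis by simp
qed

text \<open>The two occurrences of \<open>[\<delta>,\<beta>]\<close> cancel, and what is left is divisible by \<open>z - \<i>\<alpha>\<close>.\<close>

lemma dress_residue_deriv:
  assumes u: "u \<in> U"
  shows "((\<lambda>x. dress_residue x z) has_derivative
    (\<lambda>v. - (\<i> * (z - \<i> * \<alpha>)) *s (E u z *v complex_vec (\<chi> i. v $ i * dress_vec u $ i)))) (at u)"
proof -
  have "lax_matrix (\<beta> u) z v *v complex_vec (dress_vec u) - lax_matrix (\<beta> u) (\<i> * \<alpha>) v *v complex_vec (dress_vec u) =
      (\<i> * (z - \<i> * \<alpha>)) *s complex_vec (\<chi> i. v $ i * dress_vec u $ i)" for v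
    unfolding bounded_bilinear.diff_left[OF bounded_bilinear_matrix_vector_mult, symmetric]
    by (simp add: lax_matrix_diff diag_matrix_mult_vector vec_eq_iff)
  moreover have "0 - (E u z *v - (lax_matrix (\<beta> u) (\<i> * \<alpha>) v *v complex_vec (dress_vec u)) +
      (E u z ** lax_matrix (\<beta> u) z v) *v complex_vec (dress_vec u)) =
      - (E u z *v (lax_matrix (\<beta> u) z v *v complex_vec (dress_vec u) - lax_matrix (\<beta> u) (\<i> * \<alpha>) v *v complex_vec (dress_vec u)))" for v
    by (simp add: linear_diff linear_neg flip: matrix_vector_mul_assoc)
  moreover have "- (E u z *v (c *s x)) = - c *s (E u z *v x)" for c x
    by (simp add: vec_eq_iff matrix_vector_mult_def sum_distrib_left mult_ac)
  ultimately have eq: "0 - (E u z *v - (lax_matrix (\<beta> u) (\<i> * \<alpha>) v *v complex_vec (dress_vec u)) +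
      (E u z ** lax_matrix (\<beta> u) z v) *v complex_vec (dress_vec u)) =
      - (\<i> * (z - \<i> * \<alpha>)) *s (E u z *v complex_vec (\<chi> i. v $ i * dress_vec u $ i))" for v
    by simp
  show ?thesis
    using has_derivative_diff[OF has_derivative_const[of "complex_vec b"]
        bounded_bilinear.FDERIV[OF bounded_bilinear_matrix_vector_mult E_deriv[OF u, of z]
          dress_vec_complex_deriv[OF u]]]
    unfolding dress_residue_def eq .
qed

lemma dress_X_deriv_off_pole:
  assumes u: "u \<in> U" and z: "z \<noteq> \<i> * \<alpha>"
  shows "((\<lambda>x. dress_X x z) has_derivative (\<lambda>v. E u z *v complex_vec (\<chi> i. v $ i * dress_h u $ i))) (at u)"
proof -
  have "complex_vec (\<chi> i. v $ i * dress_h u $ i) =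
      complex_vec (\<chi> i. v $ i * h u $ i) + complex_vec (\<chi> i. v $ i * dress_vec u $ i)" for v
    by (simp add: vec_eq_iff dress_h_def distrib_left)
  moreover have "(\<i> / (z - \<i> * \<alpha>)) * (- (\<i> * (z - \<i> * \<alpha>))) = 1"
  proof -
    have "(\<i> / c) * (- (\<i> * c)) = 1" if "c \<noteq> 0" for c using that by simp
    from this[of "z - \<i> * \<alpha>"] show ?thesis using z unfolding right_minus_eq by blast
  qed
  then have "(\<i> / (z - \<i> * \<alpha>)) *s (- (\<i> * (z - \<i> * \<alpha>)) *s w) = w" for w :: "complex^'n"
    by (simp only: vector_smult_assoc vector_smult_lid)
  ultimately have eq: "E u z *v complex_vec (\<chi> i. v $ i * h u $ i) + (\<i> / (z - \<i> * \<alpha>)) *s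
      (- (\<i> * (z - \<i> * \<alpha>)) *s (E u z *v complex_vec (\<chi> i. v $ i * dress_vec u $ i))) =
      E u z *v complex_vec (\<chi> i. v $ i * dress_h u $ i)" for v
    by (simp only: matrix_vector_right_distrib)
  from has_derivative_add[OF X_deriv[OF u, of z] bounded_linear.has_derivative[OF
        bounded_linear_vector_scalar_mult[of "\<i> / (z - \<i> * \<alpha>)"] dress_residue_deriv[OF u, of z]]]
  have "((\<lambda>x. X x z + (\<i> / (z - \<i> * \<alpha>)) *s dress_residue x z) has_derivative
      (\<lambda>v. E u z *v complex_vec (\<chi> i. v $ i * dress_h u $ i))) (at u)"
    unfolding eq .
  then show ?thesis
    by (rule has_derivative_transform_within_open[OF _ open_U u]) (simp add: dress_X_off_pole[OF _ z])
qed

lemma smooth_dress_vec: "smooth_on U dress_vec"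
proof -
  have "bounded_linear (\<lambda>M. (\<chi> i. Re ((transpose M *v complex_vec b) $ i)) :: real^'n)"
    unfolding linear_conv_bounded_linear[symmetric]
    by (rule linearI) (simp_all add: vec_eq_iff transpose_def matrix_vector_mult_def sum.distrib algebra_simps sum_distrib_left)
  from smooth_on_bounded_linear[OF open_U this smooth_E]
  show ?thesis unfolding dress_vec_def[abs_def] .
qed

lemma smooth_dress_h: "smooth_on U dress_h"
  unfolding dress_h_def[abs_def] by (rule smooth_on_add[OF open_U smooth_h smooth_dress_vec])

text \<open>At the pole the map is the limit of the maps at nearby parameters, whose derivatives
  converge locally uniformly.\<close>

lemma dress_X_deriv_pole:
  assumes u: "u \<in> U"
  shows "((\<lambda>x. dress_X x (\<i> * \<alpha>)) has_derivative
    (\<lambda>v. E u (\<i> * \<alpha>) *v complex_vec (\<chi> i. v $ i * dress_h u $ i))) (at u)"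
proof -
  define z where "z = \<i> * complex_of_real \<alpha>"
  define \<zeta> where "\<zeta> k = z + 1 / of_nat (Suc k)" for k
  have \<zeta>: "\<zeta> \<longlonglongrightarrow> z"
    unfolding \<zeta>_def using tendsto_add[OF tendsto_const LIMSEQ_Suc[OF lim_1_over_n]] by force
  have \<zeta>_neq: "\<zeta> k \<noteq> \<i> * \<alpha>" for k by (simp add: \<zeta>_def z_def del: of_nat_Suc)
  obtain r where r: "r > 0" "cball u r \<subseteq> U" using open_U u open_contains_cball by blast
  have inU: "x \<in> U" if "x \<in> cball u r" for x using that r by blast
  define L where "L k x v = E x (\<zeta> k) *v complex_vec (\<chi> i. v $ i * dress_h x $ i)" for k x v
  define L' where "L' x v = E x z *v complex_vec (\<chi> i. v $ i * dress_h x $ i)" for x v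
  obtain K where K: "K > 0" "\<And>(A::complex^'n^'n) x. norm (A *v x) \<le> norm A * norm x * K"
    using bounded_bilinear.pos_bounded[OF bounded_bilinear_matrix_vector_mult] by blast
  have "continuous_on (cball u r) dress_h"
    using smooth_on_imp_continuous_on[OF smooth_dress_h] r(2) continuous_on_subset by blast
  from compact_imp_bounded[OF compact_continuous_image[OF this compact_cball]]
  obtain H where H: "H > 0" "\<And>x. x \<in> cball u r \<Longrightarrow> norm (dress_h x) \<le> H"
    unfolding bounded_pos by auto
  define C where "C = real CARD('n) * H * K"
  have C: "C > 0" unfolding C_def using H K by simp
  have vec_bound: "norm (complex_vec (\<chi> i. v $ i * dress_h x $ i)) \<le> real CARD('n) * H * norm v"
    if "x \<in> cball u r" for x v
  proof -
    have "norm (complex_vec (\<chi> i. v $ i * dress_h x $ i) $ i) \<le> norm v * H" for i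
      using mult_mono'[OF component_le_norm_cart[of v i]
          order_trans[OF component_le_norm_cart[of "dress_h x" i] H(2)[OF that]]]
      by (simp add: norm_mult abs_mult)
    from sum_bounded_above[of UNIV "\<lambda>i. norm (complex_vec (\<chi> i. v $ i * dress_h x $ i) $ i)", OF this]
    have "(\<Sum>i\<in>UNIV. norm (complex_vec (\<chi> i. v $ i * dress_h x $ i) $ i)) \<le> real CARD('n) * H * norm v"
      by (simp add: mult_ac)
    then show ?thesis
      unfolding norm_vec_def[of "complex_vec _"] by (rule order_trans[OF L2_set_le_sum, rotated]) simp
  qed
  have lim_deriv: "\<forall>\<^sub>F k in sequentially. \<forall>x\<in>cball u r. \<forall>v. norm (L k x v - L' x v) \<le> e * norm v" if "e > 0" for e
  proof -
    have "\<forall>\<^sub>F k in sequentially. \<forall>x\<in>cball u r. dist (E x (\<zeta> k)) (E x z) < e / C"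
      using uniform_limit_E[OF r(2,1) \<zeta>] C \<open>e > 0\<close> unfolding uniform_limit_iff by simp
    then show ?thesis
    proof eventually_elim
      case (elim k)
      show ?case
      proof (intro ballI allI)
        fix x v assume x: "x \<in> cball u r"
        have "norm (L k x v - L' x v) = norm ((E x (\<zeta> k) - E x z) *v complex_vec (\<chi> i. v $ i * dress_h x $ i))"
          by (simp add: L_def L'_def bounded_bilinear.diff_left[OF bounded_bilinear_matrix_vector_mult])
        also have "\<dots> \<le> norm (E x (\<zeta> k) - E x z) * norm (complex_vec (\<chi> i. v $ i * dress_h x $ i)) * K"
          by (rule K(2))
        also have "\<dots> \<le> (e / C) * (real CARD('n) * H * norm v) * K"
          using elim x K(1) vec_bound[OF x] by (intro mult_right_mono mult_mono') (auto simp: dist_norm less_imp_le)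
        also have "\<dots> = (e / C) * C * norm v" by (simp add: C_def mult_ac)
        also have "\<dots> = e * norm v" using C by simp
        finally show "norm (L k x v - L' x v) \<le> e * norm v" .
      qed
    qed
  qed
  have lim: "(\<lambda>k. dress_X x (\<zeta> k)) \<longlonglongrightarrow> dress_X x z" if "x \<in> U" for x
  proof (rule vec_tendstoI)
    fix i
    have "isCont (\<lambda>z. dress_X x z $ i) z"
      using holomorphic_on_imp_continuous_on[OF dress_X_holomorphic[OF that]] continuous_on_eq_continuous_at by blast
    then show "(\<lambda>k. dress_X x (\<zeta> k) $ i) \<longlonglongrightarrow> dress_X x z $ i"
      by (rule isCont_tendsto_compose) (rule \<zeta>)
  qed
  have "u \<in> cball u r" using r by simp
  have "\<exists>g. \<forall>x\<in>cball u r. (\<lambda>k. dress_X x (\<zeta> k)) \<longlonglongrightarrow> g x \<and> (g has_derivative L' x) (at x within cball u r)"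
  proof (rule has_derivative_sequence[where f = "\<lambda>k x. dress_X x (\<zeta> k)" and f' = L and g' = L',
        OF convex_cball _ lim_deriv \<open>u \<in> cball u r\<close> lim[OF u]])
    show "((\<lambda>x. dress_X x (\<zeta> k)) has_derivative L k x) (at x within cball u r)" if "x \<in> cball u r" for k x
      unfolding L_def by (rule has_derivative_at_withinI[OF dress_X_deriv_off_pole[OF inU[OF that] \<zeta>_neq]])
  qed
  then obtain g where g: "\<And>x. x \<in> cball u r \<Longrightarrow> (\<lambda>k. dress_X x (\<zeta> k)) \<longlonglongrightarrow> g x"
    "\<And>x. x \<in> cball u r \<Longrightarrow> (g has_derivative L' x) (at x within cball u r)" by blast
  have geq: "g x = dress_X x z" if "x \<in> cball u r" for x
    using LIMSEQ_unique[OF g(1)[OF that] lim[OF inU[OF that]]] .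
  have "(g has_derivative L' u) (at u within ball u r)"
    by (rule has_derivative_subset[OF g(2)]) (use r in auto)
  then have "(g has_derivative L' u) (at u)"
    using r by (simp add: at_within_open[OF _ open_ball])
  then have "((\<lambda>x. dress_X x z) has_derivative L' u) (at u)"
    by (rule has_derivative_transform_within_open[of _ _ _ _ "ball u r"]) (use r geq in auto)
  then show ?thesis unfolding L'_def z_def .
qed

lemma dress_X_deriv:
  "u \<in> U \<Longrightarrow>
    ((\<lambda>x. dress_X x z) has_derivative (\<lambda>v. E u z *v complex_vec (\<chi> i. v $ i * dress_h u $ i))) (at u)"
  using dress_X_deriv_off_pole dress_X_deriv_pole by (cases "z = \<i> * \<alpha>") simp_all

lemma egoroff_frame_dressed: "egoroff_frame U \<beta> dress_h E dress_X"
  using open_U smooth_\<beta> sym_\<beta> smooth_dress_h E_deriv dress_X_deriv E_hol dress_X_holomorphic E_transpose E_cnj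
  by unfold_locales

end

end

section \<open>Geometry of the associated family\<close>

definition herm :: "complex^'n \<Rightarrow> complex^'n \<Rightarrow> complex" where
  "herm x y = (\<Sum>k\<in>UNIV. cnj (x $ k) * y $ k)"

lemma inner_eq_Re_herm: "x \<bullet> y = Re (herm x y)"
  by (simp add: inner_vec_def herm_def inner_complex_def)

lemma herm_matrix_mult: "herm (A *v x) (B *v y) = herm x ((transpose (cnj_mat A) ** B) *v y)"
proof -
  have "herm (A *v x) w = (\<Sum>k\<in>UNIV. \<Sum>i\<in>UNIV. cnj (x $ i) * (cnj (A $ k $ i) * w $ k))" for w
    by (simp add: herm_def matrix_vector_mult_def sum_distrib_left sum_distrib_right mult_ac)
  also have "\<dots> w = (\<Sum>i\<in>UNIV. \<Sum>k\<in>UNIV. cnj (x $ i) * (cnj (A $ k $ i) * w $ k))" for w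
    by (rule sum.swap)
  also have "\<dots> w = (\<Sum>i\<in>UNIV. cnj (x $ i) * (\<Sum>k\<in>UNIV. cnj (A $ k $ i) * w $ k))" for w
    by (simp only: sum_distrib_left)
  also have "\<dots> w = herm x (transpose (cnj_mat A) *v w)" for w
    unfolding herm_def by (simp only: matrix_vector_mult_def transpose_def cnj_mat_def vec_lambda_beta)
  finally show ?thesis by (simp only: matrix_vector_mul_assoc)
qed

lemma herm_complex_vec: "herm (complex_vec p) (complex_vec q) = complex_of_real (p \<bullet> q)"
  by (simp add: herm_def inner_vec_def)

lemma herm_scalar: "herm (c *s x) y = cnj c * herm x y" "herm x (c *s y) = c * herm x y"
  by (simp_all add: herm_def sum_distrib_left mult_ac)

lemma linear_diag_matrix: "linear (diag_matrix :: real^'n \<Rightarrow> real^'n^'n)"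
  by (rule linearI) (simp_all add: vec_eq_iff diag_matrix_def)

lemma dim_diag_matrices: "dim (range (diag_matrix :: real^'n \<Rightarrow> real^'n^'n)) = CARD('n)"
proof -
  have "inj (diag_matrix :: real^'n \<Rightarrow> real^'n^'n)"
  proof
    fix x y :: "real^'n" assume "diag_matrix x = diag_matrix y"
    then have "diag_matrix x $ i $ i = diag_matrix y $ i $ i" for i by simp
    then show "x = y" by (simp add: vec_eq_iff diag_matrix_def)
  qed
  then show ?thesis
    using dim_image_eq[OF linear_diag_matrix, of UNIV] by (simp add: dim_UNIV)
qed

lemma axis_scale: "(\<chi> l. axis i 1 $ l * p $ l) = axis i (p $ i :: real)"
  by (simp add: vec_eq_iff axis_def)

text \<open>For real \<open>z\<close> the commutator is the real part of \<open>A(z)\<close> and \<open>z\<delta>\<close> its imaginary part. Applied to a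
  tangent vector, they give the tangential and the normal part of its derivative.\<close>

lemma lax_matrix_mult_complex_vec:
  "lax_matrix \<beta> (complex_of_real t) v *v complex_vec p =
    complex_vec (\<chi> i. \<Sum>j\<in>UNIV. (v $ i - v $ j) * \<beta> $ i $ j * p $ j) +
    \<i> *s complex_vec (\<chi> i. t * v $ i * p $ i)"
  by (simp add: vec_eq_iff lax_matrix_def matrix_vector_mult_def distrib_right sum.distrib
      if_distrib[of "\<lambda>x. x * _"] cong: if_cong)

context egoroff_frame
begin

text \<open>\<open>E(t)\<close> as an isometry of \<open>\<real>\<^sup>n\<close> onto the tangent space of \<open>X(\<cdot>,t)\<close> wherever
  \<open>h\<close> has no zero entry; multiplication by \<open>\<i>\<close> takes its image
  to the normal space.\<close>

definition tangent :: "real \<Rightarrow> real^'n \<Rightarrow> real^'n \<Rightarrow> complex^'n" where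
  "tangent t u p = E u (complex_of_real t) *v complex_vec p"

lemma linear_tangent: "linear (tangent t u)"
  unfolding tangent_def linear_conv_bounded_linear
  by (rule bounded_linear_compose[OF bounded_linear_matrix_vector_mult bounded_linear_complex_vec])

lemma cnj_mat_E_real: "u \<in> U \<Longrightarrow> cnj_mat (E u (complex_of_real t)) = E u (- complex_of_real t)"
  using E_cnj[of u "- complex_of_real t"] by simp

lemma herm_tangent:
  assumes "u \<in> U"
  shows "herm (tangent t u p) (tangent t u q) = complex_of_real (p \<bullet> q)"
  unfolding tangent_def herm_matrix_mult cnj_mat_E_real[OF assms] E_transpose'[OF assms]
  by (simp add: herm_complex_vec)

lemma inner_tangent:
  assumes "u \<in> U"
  shows "tangent t u p \<bullet> tangent t u q = p \<bullet> q"
    and "(\<i> *s tangent t u p) \<bullet> tangent t u q = 0"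
    and "(\<i> *s tangent t u p) \<bullet> (\<i> *s tangent t u q) = p \<bullet> q"
  by (simp_all add: inner_eq_Re_herm herm_scalar herm_tangent[OF assms])

lemma frechet_derivative_X:
  assumes "u \<in> U"
  shows "frechet_derivative (\<lambda>x. X x (complex_of_real t)) (at u) v = tangent t u (\<chi> i. v $ i * h u $ i)"
  using frechet_derivative_at[OF X_deriv[OF assms, of "complex_of_real t"]]
  by (simp add: tangent_def fun_eq_iff)

lemma tangent_space_X:
  assumes "u \<in> U" "\<And>i. h u $ i \<noteq> 0"
  shows "tangent_space (\<lambda>x. X x (complex_of_real t)) u = range (tangent t u)"
proof -
  have "tangent t u p \<in> range (\<lambda>v. tangent t u (\<chi> i. v $ i * h u $ i))" for p
    using assms(2) by (intro range_eqI[of _ _ "\<chi> i. p $ i / h u $ i"]) (simp add: vec_eq_iff)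
  then show ?thesis
    by (auto simp: tangent_space_def frechet_derivative_X[OF assms(1), abs_def])
qed

lemma normal_part_X:
  assumes "u \<in> U" "\<And>i. h u $ i \<noteq> 0"
  shows "normal_part (\<lambda>x. X x (complex_of_real t)) u (tangent t u p + \<i> *s tangent t u q) = \<i> *s tangent t u q"
  unfolding normal_part_def normal_space_def tangent_space_X[OF assms]
proof (rule the_equality)
  show "\<i> *s tangent t u q \<in> {\<xi>. \<forall>w\<in>range (tangent t u). \<xi> \<bullet> w = 0} \<and>
      tangent t u p + \<i> *s tangent t u q - \<i> *s tangent t u q \<in> range (tangent t u)"
    by (auto simp: inner_tangent[OF assms(1)])
next
  fix \<xi>
  assume *: "\<xi> \<in> {\<xi>. \<forall>w\<in>range (tangent t u). \<xi> \<bullet> w = 0} \<and>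
    tangent t u p + \<i> *s tangent t u q - \<xi> \<in> range (tangent t u)"
  then obtain r where "tangent t u p + \<i> *s tangent t u q - \<xi> = tangent t u r" by blast
  then have \<xi>: "\<i> *s tangent t u q - \<xi> = tangent t u (r - p)"
    by (simp add: linear_diff[OF linear_tangent] algebra_simps)
  have "(\<i> *s tangent t u q - \<xi>) \<bullet> tangent t u (r - p) = 0"
    using * by (simp add: inner_diff_left inner_tangent[OF assms(1)])
  then have "\<i> *s tangent t u q - \<xi> = 0" unfolding \<xi> by simp
  then show "\<xi> = \<i> *s tangent t u q" by simp
qed

lemma second_form_X:
  assumes V: "open V" "V \<subseteq> U" "\<And>u i. u \<in> V \<Longrightarrow> h u $ i \<noteq> 0" and u: "u \<in> V"
  shows "second_form (\<lambda>x. X x (complex_of_real t)) u v w = \<i> *s tangent t u (\<chi> i. t * v $ i * w $ i * h u $ i)"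
proof -
  have uU: "u \<in> U" using V u by blast
  let ?Y = "\<lambda>x. X x (complex_of_real t)" and ?E = "E u (complex_of_real t)"
  let ?hw = "\<lambda>x. \<chi> i. w $ i * h x $ i"
  have "(h has_derivative frechet_derivative h (at u)) (at u)"
    by (rule smooth_onD_has_derivative[OF smooth_h uU])
  moreover have "bounded_linear (\<lambda>p. (\<chi> i. w $ i * p $ i) :: real^'n)"
    unfolding linear_conv_bounded_linear[symmetric]
    by (rule linearI) (simp_all add: vec_eq_iff algebra_simps)
  ultimately have "((\<lambda>x. complex_vec (?hw x)) has_derivative
      (\<lambda>v. complex_vec (\<chi> i. w $ i * frechet_derivative h (at u) v $ i))) (at u)"
    by (intro bounded_linear.has_derivative[OF bounded_linear_complex_vec]) (rule bounded_linear.has_derivative)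
  from bounded_bilinear.FDERIV[OF bounded_bilinear_matrix_vector_mult E_deriv[OF uU] this]
  have "((\<lambda>x. tangent t x (?hw x)) has_derivative
      (\<lambda>v. ?E *v complex_vec (\<chi> i. w $ i * frechet_derivative h (at u) v $ i) +
        (?E ** lax_matrix (\<beta> u) (complex_of_real t) v) *v complex_vec (?hw u))) (at u)"
    unfolding tangent_def .
  from frechet_derivative_at[OF this]
  have "frechet_derivative (\<lambda>x. tangent t x (?hw x)) (at u) v =
      ?E *v complex_vec (\<chi> i. w $ i * frechet_derivative h (at u) v $ i) +
        (?E ** lax_matrix (\<beta> u) (complex_of_real t) v) *v complex_vec (?hw u)"
    by (simp add: fun_eq_iff)
  also have "\<dots> = tangent t u ((\<chi> i. w $ i * frechet_derivative h (at u) v $ i) +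
        (\<chi> i. \<Sum>j\<in>UNIV. (v $ i - v $ j) * \<beta> u $ i $ j * ?hw u $ j)) +
      \<i> *s tangent t u (\<chi> i. t * v $ i * ?hw u $ i)"
    by (simp only: linear_add[OF bounded_linear.linear[OF bounded_linear_complex_vec]] tangent_def lax_matrix_mult_complex_vec
        matrix_vector_mul_assoc[symmetric] matrix_vector_right_distrib vector_scalar_commute add.assoc)
  also have "frechet_derivative (\<lambda>x. tangent t x (?hw x)) (at u) v =
      frechet_derivative (\<lambda>x. frechet_derivative ?Y (at x) w) (at u) v"
    by (rule fun_cong[OF frechet_derivative_cong_open[OF open_U uU]]) (simp add: frechet_derivative_X)
  finally show ?thesis
    using normal_part_X[OF uU V(3)[OF u]] by (simp add: second_form_def mult.assoc)
qed

text \<open>The second form vanishes on distinct coordinate directions, so shape operators are diagonal.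
  Conversely, the normal vector \<open>\<i>E(t)(c\<^sub>i h\<^sub>i / t)\<close> has the shape operator \<open>diag(c)\<close>.\<close>

lemma shape_operators_X:
  assumes V: "open V" "V \<subseteq> U" "\<And>u i. u \<in> V \<Longrightarrow> h u $ i \<noteq> 0" and u: "u \<in> V" and t: "t \<noteq> 0"
  shows "shape_operators (\<lambda>x. X x (complex_of_real t)) u = range diag_matrix"
proof (intro equalityI subsetI)
  have uU: "u \<in> U" using V u by blast
  have second: "second_form (\<lambda>x. X x (complex_of_real t)) u v w =
      \<i> *s tangent t u (\<chi> i. t * v $ i * w $ i * h u $ i)" for v w
    by (rule second_form_X[OF V u])
  note facts = shape_operators_def second frechet_derivative_X[OF uU] normal_space_def
    tangent_space_X[OF uU V(3)[OF u]]
  fix A :: "real^'n^'n"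
  {
    assume "A \<in> shape_operators (\<lambda>x. X x (complex_of_real t)) u"
    then obtain \<xi> where A: "\<And>v w. tangent t u (\<chi> i. (A *v v) $ i * h u $ i) \<bullet> tangent t u (\<chi> i. w $ i * h u $ i) =
        (\<i> *s tangent t u (\<chi> i. t * v $ i * w $ i * h u $ i)) \<bullet> \<xi>"
      by (auto simp: facts)
    have "A $ i $ j = 0" if "i \<noteq> j" for i j
    proof -
      have "(\<chi> k. t * axis j 1 $ k * axis i 1 $ k * h u $ k) = 0"
        using that by (simp add: vec_eq_iff axis_def)
      with A[of "axis j 1" "axis i 1"]
      have "(\<chi> k. (A *v axis j 1) $ k * h u $ k) \<bullet> (\<chi> k. axis i 1 $ k * h u $ k) = 0"
        by (simp add: inner_tangent[OF uU] linear_0[OF linear_tangent])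
      then have "(A *v axis j 1) $ i * h u $ i * h u $ i = 0"
        by (simp add: axis_scale inner_axis)
      moreover have "(A *v axis j 1) $ i = A $ i $ j"
        by (simp add: matrix_vector_mult_basis column_def)
      ultimately show ?thesis using V(3)[OF u, of i] by simp
    qed
    then have "A = diag_matrix (\<chi> i. A $ i $ i)"
      by (simp add: vec_eq_iff diag_matrix_def)
    then show "A \<in> range diag_matrix" by blast
  }
  {
    assume "A \<in> range diag_matrix"
    then obtain c :: "real^'n" where A: "A = diag_matrix c" by blast
    define \<xi> where "\<xi> = \<i> *s tangent t u (\<chi> i. c $ i * h u $ i / t)"
    have "\<forall>w\<in>range (tangent t u). \<xi> \<bullet> w = 0" by (auto simp: \<xi>_def inner_tangent[OF uU])
    moreover have "tangent t u (\<chi> i. (A *v v) $ i * h u $ i) \<bullet> tangent t u (\<chi> i. w $ i * h u $ i) =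
        (\<i> *s tangent t u (\<chi> i. t * v $ i * w $ i * h u $ i)) \<bullet> \<xi>" for v w
      unfolding \<xi>_def inner_tangent[OF uU] using t
      by (simp add: A diag_matrix_mult_vector inner_vec_def mult_ac)
    ultimately show "A \<in> shape_operators (\<lambda>x. X x (complex_of_real t)) u"
      unfolding facts by blast
  }
qed

lemma first_form_X:
  assumes "u \<in> U"
  shows "first_form (\<lambda>x. X x (complex_of_real t)) u = diagonal_metric h u"
proof -
  have "partial i (\<lambda>x. X x (complex_of_real t)) u \<bullet> partial j (\<lambda>x. X x (complex_of_real t)) u =
      axis i (h u $ i) \<bullet> axis j (h u $ j)" for i j
    by (simp only: partial_def frechet_derivative_X[OF assms] axis_scale inner_tangent[OF assms])
  then show ?thesis
    by (simp add: first_form_def vec_eq_iff diagonal_metric_def diag_matrix_def inner_axis_axis power2_eq_square)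
qed

text \<open>At \<open>z = 0\<close> the frame is real, so \<open>Re X(\<cdot>,0)\<close> is a local isometry into \<open>\<real>\<^sup>n\<close>.\<close>

lemma flat_diagonal_metric:
  assumes V: "open V" "V \<subseteq> U" "\<And>u i. u \<in> V \<Longrightarrow> h u $ i \<noteq> 0"
  shows "flat_metric_on V (diagonal_metric h)"
proof -
  define f :: "real^'n \<Rightarrow> real^'n" where "f u = (\<chi> i. Re (X u 0 $ i))" for u
  have bl: "bounded_linear (\<lambda>x. (\<chi> i. Re (x $ i)) :: real^'n)"
    unfolding linear_conv_bounded_linear[symmetric]
    by (rule linearI) (simp_all add: vec_eq_iff)
  have f: "smooth_on V f"
    unfolding f_def[abs_def] by (rule smooth_on_bounded_linear[OF V(1) bl smooth_on_subset[OF smooth_X V(2)]])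
  have pf: "partial i f u = (\<chi> k. Re (tangent 0 u (\<chi> l. axis i 1 $ l * h u $ l) $ k))" if "u \<in> V" for u i
    unfolding f_def[abs_def] tangent_def of_real_0
    by (rule partial_eqI[OF bounded_linear.has_derivative[OF bl X_deriv]]) (use that V(2) in blast)
  have real: "Im (tangent 0 u p $ k) = 0" if "u \<in> V" for u p k
  proof -
    have "u \<in> U" using that V(2) by blast
    have "cnj (E u 0 $ i $ j) = E u 0 $ i $ j" for i j
      using arg_cong[OF E_cnj[OF \<open>u \<in> U\<close>, of 0], of "\<lambda>M. M $ i $ j"] by (simp add: cnj_mat_def)
    then have "cnj (tangent 0 u p $ k) = tangent 0 u p $ k"
      by (simp add: tangent_def matrix_vector_mult_def)
    then show ?thesis by (metis Reals_cnj_iff complex_is_Real_iff)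
  qed
  have "partial i f u \<bullet> partial j f u = (if i = j then (h u $ i)\<^sup>2 else 0)" if u: "u \<in> V" for u i j
  proof -
    have uU: "u \<in> U" using V(2) u by blast
    have "partial i f u \<bullet> partial j f u =
        tangent 0 u (\<chi> l. axis i 1 $ l * h u $ l) \<bullet> tangent 0 u (\<chi> l. axis j 1 $ l * h u $ l)"
      by (simp add: pf[OF u] inner_vec_def inner_complex_def real[OF u])
    also have "\<dots> = first_form (\<lambda>x. X x (complex_of_real 0)) u $ i $ j"
      by (simp only: first_form_def partial_def frechet_derivative_X[OF uU] vec_lambda_beta)
    finally show ?thesis
      by (simp only: first_form_X[OF uU]) (simp add: diagonal_metric_def diag_matrix_def)
  qed
  from flat_metric_on_diagonal_metric[OF V(1) f smooth_on_subset[OF smooth_h V(2)] V(3) this]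
  show ?thesis .
qed

text \<open>Lagrangian: the Hermitian product of two tangent vectors is the Hermitian product of two real
  vectors, because \<open>E(t)\<close> is unitary. Immersion: \<open>E(t)\<close> and \<open>diag(h)\<close> are invertible.\<close>

lemma flat_lagrangian_family_X:
  assumes V: "open V" "V \<subseteq> U" "\<And>u i. u \<in> V \<Longrightarrow> h u $ i \<noteq> 0"
  shows "flat_lagrangian_family_on V h X"
  unfolding flat_lagrangian_family_on_def Let_def
proof (intro allI impI conjI ballI)
  fix t :: real assume t: "t \<noteq> 0"
  let ?Y = "\<lambda>x. X x (complex_of_real t)"
  have VU: "u \<in> U" if "u \<in> V" for u using that V by blast
  show "flat_lagrangian_immersion_on V ?Y"
    unfolding flat_lagrangian_immersion_on_def immersion_on_def lagrangian_on_def
  proof (intro conjI ballI allI)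
    show "smooth_on V ?Y" by (rule smooth_on_subset[OF smooth_X V(2)])
    show "inj (frechet_derivative ?Y (at u))" if u: "u \<in> V" for u
    proof (rule linear_injective_0[THEN iffD2])
      show "linear (frechet_derivative ?Y (at u))"
        by (rule linear_frechet_derivative[OF differentiableI[OF X_deriv[OF VU[OF u]]]])
      show "\<forall>v. frechet_derivative ?Y (at u) v = 0 \<longrightarrow> v = 0"
      proof (intro allI impI)
        fix v assume "frechet_derivative ?Y (at u) v = 0"
        then have "tangent t u (\<chi> i. v $ i * h u $ i) \<bullet> tangent t u (\<chi> i. v $ i * h u $ i) = 0"
          by (simp add: frechet_derivative_X[OF VU[OF u]])
        then have "(\<chi> i. v $ i * h u $ i) = 0" by (simp add: inner_tangent[OF VU[OF u]])
        then show "v = 0" using V(3)[OF u] by (simp add: vec_eq_iff)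
      qed
    qed
    show "Im (\<Sum>k\<in>UNIV. cnj (frechet_derivative ?Y (at u) v $ k) * frechet_derivative ?Y (at u) w $ k) = 0"
      if "u \<in> V" for u v w
      unfolding frechet_derivative_X[OF VU[OF that]] herm_def[symmetric] herm_tangent[OF VU[OF that]] by simp
    show "flat_metric_on V (first_form ?Y)"
    proof (rule iffD2[OF flat_metric_on_cong[OF V(1)]])
      show "first_form ?Y u = diagonal_metric h u" if "u \<in> V" for u
        by (rule first_form_X[OF VU[OF that]])
      show "flat_metric_on V (diagonal_metric h)" by (rule flat_diagonal_metric[OF V])
    qed
  qed
  show "nondegenerate_normal_bundle_on V ?Y"
    unfolding nondegenerate_normal_bundle_on_def
    by (simp add: shape_operators_X[OF V _ t] dim_diag_matrices)
  fix u assume u: "u \<in> V"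
  show "first_form ?Y u = diagonal_metric h u" by (rule first_form_X[OF VU[OF u]])
  fix v w
  have "linear (\<lambda>p. \<i> *s tangent t u p)"
    using bounded_linear.linear[OF bounded_linear_vector_scalar_mult] linear_compose[OF linear_tangent]
    by (fastforce simp: o_def)
  note lin = linear_sum[OF this] linear_scale[OF this]
  have "(\<chi> i. t * v $ i * w $ i * h u $ i) =
      t *\<^sub>R (\<Sum>i\<in>UNIV. (v $ i * w $ i) *\<^sub>R (\<chi> l. axis i 1 $ l * h u $ l))"
    by (simp add: vec_eq_iff axis_def if_distrib[of "\<lambda>x. x * _"] if_distrib[of "\<lambda>x. _ * x"] mult.assoc cong: if_cong)
  then show "second_form ?Y u v w = t *\<^sub>R (\<Sum>i\<in>UNIV. (v $ i * w $ i) *\<^sub>R (\<i> *s partial i ?Y u))"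
    by (simp only: second_form_X[OF V u] lin partial_def frechet_derivative_X[OF VU[OF u]])
qed

end

section \<open>Uniqueness of the factorization\<close>

lemma holomorphic_normalised_at_infinity_tendsto:
  assumes "holomorphic_normalised_at_infinity k"
  shows "(k \<longlongrightarrow> mat 1) at_infinity"
proof (intro vec_tendstoI)
  fix r s
  let ?f = "\<lambda>w. (if w = 0 then mat 1 else k (1 / w)) $ r $ s"
  obtain \<rho> where \<rho>: "\<rho> > 0" "?f holomorphic_on ball 0 \<rho>"
    using assms unfolding holomorphic_normalised_at_infinity_def entrywise_holomorphic_on_def by blast
  have "(0::complex) \<in> ball 0 \<rho>" using \<rho>(1) by simp
  with holomorphic_on_imp_continuous_on[OF \<rho>(2)] have "isCont ?f 0"
    unfolding continuous_on_eq_continuous_at[OF open_ball] by blast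
  then have "((\<lambda>z. ?f (inverse z)) \<longlongrightarrow> ?f 0) at_infinity"
    by (rule isCont_tendsto_compose[OF _ tendsto_inverse_0])
  then have "((\<lambda>z. ?f (inverse z)) \<longlongrightarrow> mat 1 $ r $ s) at_infinity" by simp
  moreover have "\<forall>\<^sub>F z in at_infinity. ?f (inverse z) = k z $ r $ s"
    unfolding eventually_at_infinity by (rule exI[of _ 1]) (auto simp: inverse_eq_divide)
  ultimately show "((\<lambda>z. k z $ r $ s) \<longlongrightarrow> mat 1 $ r $ s) at_infinity"
    by (rule Lim_transform_eventually)
qed

text \<open>From \<open>M = l + M (I - k)\<close> the matrix \<open>M\<close> is bounded near \<open>\<infinity>\<close>, hence tends to \<open>I\<close> there, and Liouville's
  theorem applies to its entries.\<close>

lemma entire_matrix_eq_one: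
  fixes M :: "complex \<Rightarrow> complex^'m^'m"
  assumes M: "entrywise_holomorphic_on M UNIV"
    and k: "(k \<longlongrightarrow> mat 1) at_infinity" and l: "(l \<longlongrightarrow> mat 1) at_infinity"
    and eq: "\<forall>\<^sub>F z in at_infinity. M z ** k z = l z"
  shows "M z = mat 1"
proof -
  obtain K where K: "K > 0" "\<And>(A::complex^'m^'m) (B::complex^'m^'m). norm (A ** B) \<le> norm A * norm B * K"
    using bounded_bilinear.pos_bounded[OF bounded_bilinear_matrix_mult] by blast
  have k0: "((\<lambda>z. norm (mat 1 - k z)) \<longlongrightarrow> 0) at_infinity"
    using tendsto_norm[OF tendsto_diff[OF tendsto_const[of "mat 1"] k]] by simp
  have "((\<lambda>z. norm (mat 1 - k z) * K) \<longlongrightarrow> 0) at_infinity"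
    using tendsto_mult[OF k0 tendsto_const[of K]] by simp
  then have small: "\<forall>\<^sub>F z in at_infinity. norm (mat 1 - k z) * K < 1 / 2"
    by (rule order_tendstoD) simp
  have "\<forall>\<^sub>F z in at_infinity. norm (M z - l z) \<le> 2 * norm (l z) * norm (mat 1 - k z) * K"
    using eq small
  proof eventually_elim
    case (elim z)
    have diff: "M z - l z = M z ** (mat 1 - k z)"
      using elim(1) by (simp add: bounded_bilinear.diff_right[OF bounded_bilinear_matrix_mult])
    have le: "norm (M z - l z) \<le> norm (M z) * (norm (mat 1 - k z) * K)"
      unfolding diff using K(2)[of "M z" "mat 1 - k z"] by (simp add: mult.assoc)
    also have "\<dots> \<le> norm (M z) * (1 / 2)"
      using elim(2) by (intro mult_left_mono) auto
    finally have "norm (M z - l z) \<le> norm (M z) * (1 / 2)" .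
    then have "norm (M z) \<le> 2 * norm (l z)"
      using norm_triangle_ineq2[of "M z" "l z"] by simp
    then have "norm (M z) * (norm (mat 1 - k z) * K) \<le> 2 * norm (l z) * (norm (mat 1 - k z) * K)"
      using K(1) by (intro mult_right_mono) auto
    with le show ?case by (simp add: mult.assoc)
  qed
  moreover have "((\<lambda>z. 2 * norm (l z) * norm (mat 1 - k z) * K) \<longlongrightarrow> 2 * norm (mat 1 :: complex^'m^'m) * 0 * K) at_infinity"
    by (rule tendsto_mult[OF tendsto_mult[OF tendsto_mult[OF tendsto_const tendsto_norm[OF l]] k0] tendsto_const])
  then have "((\<lambda>z. 2 * norm (l z) * norm (mat 1 - k z) * K) \<longlongrightarrow> 0) at_infinity" by simp
  ultimately have "((\<lambda>z. M z - l z) \<longlongrightarrow> 0) at_infinity"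
    by (rule Lim_null_comparison)
  from tendsto_add[OF this l] have lim: "(M \<longlongrightarrow> mat 1) at_infinity" by simp
  show ?thesis
    unfolding vec_eq_iff
  proof (intro allI)
    fix r s
    show "M z $ r $ s = mat 1 $ r $ s"
      using M lim unfolding entrywise_holomorphic_on_def
      by (intro Liouville_weak[of "\<lambda>z. M z $ r $ s"] tendsto_vec_nth) auto
  qed
qed

text \<open>In the chart \<open>w = 1/z\<close> the coefficient \<open>\<i>/(z - a)\<close> becomes \<open>\<i>w/(1 - aw)\<close>, holomorphic for
  \<open>\<bar>w\<bar> < 1/\<bar>a\<bar>\<close>.\<close>

lemma simple_element_normalised: "holomorphic_normalised_at_infinity (simple_element a b)"
proof -
  \<comment> \<open>the summand \<open>1\<close> covers \<open>a = 0\<close>\<close>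
  define r where "r = 1 / (norm a + 1)"
  have r: "r > 0" unfolding r_def by (simp add: add_nonneg_pos)
  have den: "1 - a * w \<noteq> 0" if "w \<in> ball 0 r" for w
  proof
    assume "1 - a * w = 0"
    then have "norm a * norm w = 1" by (metis eq_iff_diff_eq_0 norm_mult norm_one)
    moreover have "norm w * (norm a + 1) < 1"
      using that by (simp add: r_def pos_less_divide_eq add_nonneg_pos)
    ultimately show False using norm_ge_zero[of w] by (simp add: distrib_left mult.commute)
  qed
  have eq: "(if w = 0 then mat 1 else simple_element a b (1 / w)) =
      affine_block (mat 1) ((\<i> * w / (1 - a * w)) *s complex_vec b) 1" for w
  proof (cases "w = 0")
    case True
    then show ?thesis by (simp add: option_matrix_eq_iff mat_def)
  next
    case False
    then have "\<i> / (1 / w - a) = \<i> * w / (1 - a * w)"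
      by (simp add: divide_diff_eq_iff)
    then show ?thesis using False by (simp add: simple_element_def)
  qed
  have "entrywise_holomorphic_on (\<lambda>w. affine_block (mat 1) ((\<i> * w / (1 - a * w)) *s complex_vec b) 1) (ball 0 r)"
    unfolding entrywise_holomorphic_on_def split_option_all
    by (simp, intro allI conjI holomorphic_intros den)
  then show ?thesis
    unfolding holomorphic_normalised_at_infinity_def eq using r by blast
qed

context egoroff_frame
begin

text \<open>The inverse of the frame needs no cofactors, since \<open>E(z)\<^sup>-\<^sup>1 = E(-z)\<^sup>t\<close>; in this form it is
  visibly entire.\<close>

lemma affine_block_frame_inverse:
  assumes "u \<in> U"
  shows "affine_block (E u z) (X u z) 1 ** affine_block (transpose (E u (- z))) (- (transpose (E u (- z)) *v X u z)) 1 = mat 1"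
  by (rule affine_block_inverse[OF E_transpose[OF assms]])

lemma frame_equation: "frame_equation_on U \<beta> h (\<lambda>u z. affine_block (E u z) (X u z) 1)"
proof (rule frame_equation_on_affine_blockI)
  show "invertible (affine_block (E u z) (X u z) 1)" if "u \<in> U" for u z
    using affine_block_frame_inverse[OF that] unfolding invertible_right_inverse by blast
qed (rule E_hol X_hol E_deriv X_deriv, assumption)+

lemma entrywise_holomorphic_frame:
  assumes "u \<in> U"
  shows "entrywise_holomorphic_on (\<lambda>z. affine_block (E u z) (X u z) 1) UNIV"
  using frame_equation assms unfolding frame_equation_on_def by blast

lemma entrywise_holomorphic_frame_inverse:
  assumes "u \<in> U"
  shows "entrywise_holomorphic_on
    (\<lambda>z. affine_block (transpose (E u (- z))) (- (transpose (E u (- z)) *v X u z)) 1) UNIV"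
proof -
  have E: "(\<lambda>z. E u (- z) $ i $ j) holomorphic_on UNIV" for i j
    using holomorphic_on_compose[of uminus UNIV "\<lambda>z. E u z $ i $ j"] holomorphic_on_subset[OF E_hol[OF assms]]
    by (simp add: o_def holomorphic_on_minus)
  then have ET: "(\<lambda>z. transpose (E u (- z)) $ i $ j) holomorphic_on UNIV" for i j
    by (simp add: transpose_def)
  have TX: "(\<lambda>z. (transpose (E u (- z)) *v X u z) $ i) holomorphic_on UNIV" for i
    unfolding matrix_vector_mult_def transpose_def
    by (simp only: vec_lambda_beta, intro holomorphic_intros E X_hol[OF assms])
  then show ?thesis
    unfolding entrywise_holomorphic_on_def split_option_all
    by (simp add: ET TX holomorphic_on_minus del: transpose_matrix_vector)
qed

text \<open>Any two factorizations differ by \<open>F\<^sup>-\<^sup>1 G\<close>, which is entire in \<open>z\<close> and equal to \<open>I\<close> at \<open>\<infinity>\<close>.\<close>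

lemma dressing_factor_unique:
  assumes u: "u \<in> U" and k': "holomorphic_normalised_at_infinity k'" and k'': "holomorphic_normalised_at_infinity k''"
    and G: "entrywise_holomorphic_on G UNIV"
    and eq: "\<forall>\<^sub>F z in at_infinity. G z ** k'' z = affine_block (E u z) (X u z) 1 ** k' z"
  shows "G z = affine_block (E u z) (X u z) 1"
proof -
  define F F' where "F z = affine_block (E u z) (X u z) 1"
    and "F' z = affine_block (transpose (E u (- z))) (- (transpose (E u (- z)) *v X u z)) 1" for z
  have FF': "F z ** F' z = mat 1" for z
    unfolding F_def F'_def by (rule affine_block_frame_inverse[OF u])
  then have F'F: "F' z ** F z = mat 1" for z
    by (rule iffD1[OF matrix_left_right_inverse])
  have "entrywise_holomorphic_on (\<lambda>z. F' z ** G z) UNIV"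
    using entrywise_holomorphic_frame_inverse[OF u] G
    unfolding entrywise_holomorphic_on_def F'_def[symmetric]
    by (auto simp: matrix_matrix_mult_def intro!: holomorphic_intros)
  moreover have "\<forall>\<^sub>F z in at_infinity. (F' z ** G z) ** k'' z = k' z"
    using eq
  proof eventually_elim
    case (elim z)
    then have "F' z ** (G z ** k'' z) = (F' z ** F z) ** k' z"
      by (simp add: F_def matrix_mul_assoc)
    then show ?case by (simp add: F'F matrix_mul_assoc)
  qed
  ultimately have "F' z ** G z = mat 1"
    by (rule entire_matrix_eq_one[OF _ holomorphic_normalised_at_infinity_tendsto[OF k'']
          holomorphic_normalised_at_infinity_tendsto[OF k']])
  then have "F z ** (F' z ** G z) = F z" by simp
  then show ?thesis by (simp add: matrix_mul_assoc FF' F_def[symmetric])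
qed

end

section \<open>The dressed frame and its geometry\<close>

lemma frame_equation_on_cong:
  assumes "frame_equation_on U \<beta> h F" "V \<subseteq> U" "\<And>u. u \<in> V \<Longrightarrow> \<beta> u = \<beta>' u"
  shows "frame_equation_on V \<beta>' h F"
  using assms unfolding frame_equation_on_def by (metis subsetD)

context
  fixes U :: "(real^'n) set" and \<beta> h E X and \<alpha> :: real and b :: "real^'n"
  assumes frame: "egoroff_frame U \<beta> h E X"
begin

interpretation egoroff_frame U \<beta> h E X by (rule frame)

interpretation dressed: egoroff_frame U \<beta> "dress_h \<alpha> b" E "dress_X \<alpha> b"
  by (rule egoroff_frame_dressed)

text \<open>Comparing the last columns of both sides determines the second factor: it is the simple element
  with the same pole and \<open>g\<close> in place of \<open>b\<close>.\<close>

lemma simple_element_factorization: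
  assumes "u \<in> U" "z \<noteq> \<i> * \<alpha>"
  shows "simple_element (\<i> * \<alpha>) b z ** affine_block (E u z) (X u z) 1 =
    affine_block (E u z) (dress_X \<alpha> b u z) 1 ** simple_element (\<i> * \<alpha>) (dress_vec \<alpha> b u) z"
proof -
  let ?c = "\<i> / (z - \<i> * \<alpha>)"
  have "?c *s dress_residue \<alpha> b u z = ?c *s complex_vec b - E u z *v (?c *s complex_vec (dress_vec \<alpha> b u))"
    unfolding dress_residue_def vector_scalar_commute by (simp add: vec_eq_iff algebra_simps)
  then have "X u z + ?c *s complex_vec b = E u z *v (?c *s complex_vec (dress_vec \<alpha> b u)) + dress_X \<alpha> b u z"
    by (simp add: dress_X_off_pole[OF assms])
  then show ?thesis
    by (simp add: simple_element_def affine_block_mult)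
qed

lemma dressing_on_simple_element:
  "dressing_on U (simple_element (\<i> * \<alpha>) b) (\<lambda>u z. affine_block (E u z) (X u z) 1)
    (\<lambda>u z. affine_block (E u z) (dress_X \<alpha> b u z) 1)"
  unfolding dressing_on_def
proof (intro ballI conjI allI exI)
  fix u assume u: "u \<in> U"
  show "entrywise_holomorphic_on (\<lambda>z. affine_block (E u z) (dress_X \<alpha> b u z) 1) UNIV"
    by (rule dressed.entrywise_holomorphic_frame[OF u])
  show "invertible (affine_block (E u z) (dress_X \<alpha> b u z) 1)" for z
    using dressed.affine_block_frame_inverse[OF u] unfolding invertible_right_inverse by blast
  show "holomorphic_normalised_at_infinity (simple_element (\<i> * \<alpha>) (dress_vec \<alpha> b u))"
    by (rule simple_element_normalised)
  show "\<forall>\<^sub>F z in at_infinity. simple_element (\<i> * \<alpha>) b z ** affine_block (E u z) (X u z) 1 =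
      affine_block (E u z) (dress_X \<alpha> b u z) 1 ** simple_element (\<i> * \<alpha>) (dress_vec \<alpha> b u) z"
    unfolding eventually_at_infinity
  proof (intro exI allI impI)
    fix z :: complex assume "\<bar>\<alpha>\<bar> + 1 \<le> norm z"
    then have "z \<noteq> \<i> * \<alpha>" by (auto simp: norm_mult)
    then show "simple_element (\<i> * \<alpha>) b z ** affine_block (E u z) (X u z) 1 =
        affine_block (E u z) (dress_X \<alpha> b u z) 1 ** simple_element (\<i> * \<alpha>) (dress_vec \<alpha> b u) z"
      by (rule simple_element_factorization[OF u])
  qed
qed

lemma dressing_on_simple_element_unique:
  assumes "dressing_on U (simple_element (\<i> * \<alpha>) b) (\<lambda>u z. affine_block (E u z) (X u z) 1) G" "u \<in> U"
  shows "G u z = affine_block (E u z) (dress_X \<alpha> b u z) 1"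
proof -
  let ?eq = "\<lambda>G k. \<forall>\<^sub>F z in at_infinity. simple_element (\<i> * \<alpha>) b z ** affine_block (E u z) (X u z) 1 = G z ** k z"
  obtain k'' where k'': "holomorphic_normalised_at_infinity k''" "?eq (G u) k''"
    and G: "entrywise_holomorphic_on (G u) UNIV"
    using assms unfolding dressing_on_def by blast
  obtain k' where k': "holomorphic_normalised_at_infinity k'"
    "?eq (\<lambda>z. affine_block (E u z) (dress_X \<alpha> b u z) 1) k'"
    using dressing_on_simple_element assms(2) unfolding dressing_on_def by blast
  have "\<forall>\<^sub>F z in at_infinity. G u z ** k'' z = affine_block (E u z) (dress_X \<alpha> b u z) 1 ** k' z"
    using k''(2) k'(2) by eventually_elim simp
  then show ?thesis by (rule dressed.dressing_factor_unique[OF assms(2) k'(1) k''(1) G])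
qed

text \<open>Where \<open>E = I\<close> for all \<open>z\<close> one has \<open>g = b\<close>, so \<open>b - E(z) g\<close> vanishes identically in \<open>z\<close>.\<close>

lemma dressed_initial:
  assumes "w \<in> U" "\<And>z. E w z = mat 1" "\<And>z. X w z = 0"
  shows "affine_block (E w z) (dress_X \<alpha> b w z) 1 = mat 1"
proof -
  have "complex_vec (dress_vec \<alpha> b w) = complex_vec b"
    by (simp add: complex_vec_dress_vec'[OF assms(1)] assms(2) del: transpose_matrix_vector)
  then have "dress_residue \<alpha> b w z = 0" for z
    by (simp add: dress_residue_def assms(2))
  then have "dress_X \<alpha> b w z = 0"
    by (simp add: dress_X_def assms(3) vec_eq_iff)
  then show ?thesis by (simp add: assms(2) affine_block_one)
qed

text \<open>\<open>2 b \<cdot> Re X(\<cdot>,-\<i>\<alpha>)\<close> is a potential of the forms \<open>2 h\<^sub>i g\<^sub>i\<close>, and \<open>\<bar>g\<bar>\<^sup>2 / (2\<alpha>)\<close> of the \<open>g\<^sub>i\<^sup>2\<close>, because the skew part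
  of \<open>dg\<close> does not contribute to \<open>d\<bar>g\<bar>\<^sup>2\<close>.\<close>

lemma dressed_potential:
  assumes \<phi>: "\<phi> differentiable (at u)" "\<And>i. partial i \<phi> u = (h u $ i)\<^sup>2" and u: "u \<in> U"
    and \<alpha>: "\<alpha> \<noteq> 0"
  defines "\<psi> \<equiv> \<lambda>x. \<phi> x + (2 * (b \<bullet> (\<chi> i. Re (X x (- (\<i> * \<alpha>)) $ i))) +
    (dress_vec \<alpha> b x \<bullet> dress_vec \<alpha> b x) / (2 * \<alpha>))"
  shows "\<psi> differentiable (at u)" "partial i \<psi> u = (dress_h \<alpha> b u $ i)\<^sup>2"
proof -
  let ?g = "dress_vec \<alpha> b"
  let ?g' = "\<lambda>v. \<chi> i. \<alpha> * v $ i * ?g u $ i - (\<Sum>k\<in>UNIV. (v $ i - v $ k) * \<beta> u $ i $ k * ?g u $ k)"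
  have "bounded_linear (\<lambda>x::complex^'n. b \<bullet> (\<chi> i. Re (x $ i)))"
    unfolding linear_conv_bounded_linear[symmetric]
    by (rule linearI) (simp_all add: inner_vec_def distrib_left sum.distrib sum_distrib_left mult_ac)
  from bounded_linear.has_derivative[OF this X_deriv[OF u]]
  have dX: "((\<lambda>x. b \<bullet> (\<chi> i. Re (X x (- (\<i> * \<alpha>)) $ i))) has_derivative
      (\<lambda>v. b \<bullet> (\<chi> i. Re ((E u (- (\<i> * \<alpha>)) *v complex_vec (\<chi> i. v $ i * h u $ i)) $ i)))) (at u)" .
  have X_eq: "b \<bullet> (\<chi> i. Re ((E u (- (\<i> * \<alpha>)) *v complex_vec p) $ i)) = p \<bullet> ?g u" for p
  proof -
    have "b \<bullet> (\<chi> i. Re ((E u (- (\<i> * \<alpha>)) *v complex_vec p) $ i)) =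
        (\<Sum>k\<in>UNIV. \<Sum>j\<in>UNIV. b $ k * (Re (E u (- (\<i> * \<alpha>)) $ k $ j) * p $ j))"
      by (simp add: inner_vec_def matrix_vector_mult_def sum_distrib_left)
    also have "\<dots> = (\<Sum>j\<in>UNIV. \<Sum>k\<in>UNIV. b $ k * (Re (E u (- (\<i> * \<alpha>)) $ k $ j) * p $ j))"
      by (rule sum.swap)
    also have "\<dots> = p \<bullet> ?g u"
      by (simp add: inner_vec_def dress_vec_def matrix_vector_mult_def transpose_def sum_distrib_left mult_ac
          del: transpose_matrix_vector)
    finally show ?thesis .
  qed
  have g_eq: "?g u \<bullet> ?g' v = \<alpha> * (\<Sum>i\<in>UNIV. v $ i * (?g u $ i)\<^sup>2)" for v
  proof -
    \<comment> \<open>the contribution of \<open>[\<delta>,\<beta>]\<close>, which is skew under exchange of \<open>i\<close> and \<open>k\<close>\<close>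
    define S where "S = (\<Sum>i\<in>UNIV. \<Sum>k\<in>UNIV. ?g u $ i * ((v $ i - v $ k) * \<beta> u $ i $ k * ?g u $ k))"
    have sym: "\<beta> u $ i $ k = \<beta> u $ k $ i" for i k
      using arg_cong[OF sym_\<beta>[OF u], of "\<lambda>M. M $ k $ i"] by (simp add: transpose_def)
    have "S = (\<Sum>k\<in>UNIV. \<Sum>i\<in>UNIV. ?g u $ i * ((v $ i - v $ k) * \<beta> u $ i $ k * ?g u $ k))"
      unfolding S_def by (rule sum.swap)
    also have "\<dots> = (\<Sum>k\<in>UNIV. \<Sum>i\<in>UNIV. - (?g u $ k * ((v $ k - v $ i) * \<beta> u $ k $ i * ?g u $ i)))"
      by (intro sum.cong refl) (simp add: sym algebra_simps)
    also have "\<dots> = - S" by (simp add: S_def sum_negf)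
    finally have "S = 0" by simp
    moreover have "?g u \<bullet> ?g' v = \<alpha> * (\<Sum>i\<in>UNIV. v $ i * (?g u $ i)\<^sup>2) - S"
      by (simp add: S_def inner_vec_def right_diff_distrib sum_subtractf sum_distrib_left power2_eq_square mult_ac)
    ultimately show ?thesis by simp
  qed
  have deriv: "(\<psi> has_derivative (\<lambda>v. frechet_derivative \<phi> (at u) v +
      (2 * ((\<chi> i. v $ i * h u $ i) \<bullet> ?g u) + (?g u \<bullet> ?g' v + ?g' v \<bullet> ?g u) / (2 * \<alpha>)))) (at u)"
    unfolding \<psi>_def
    by (intro has_derivative_add bounded_linear.has_derivative[OF bounded_linear_mult_right dX[unfolded X_eq]]
        bounded_linear.has_derivative[OF bounded_linear_divide]
        has_derivative_inner[OF dress_vec_deriv[OF u] dress_vec_deriv[OF u]]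
        frechet_derivative_works[THEN iffD1, OF \<phi>(1)])
  then show "\<psi> differentiable (at u)" by (rule differentiableI)
  have "partial i \<psi> u = (h u $ i)\<^sup>2 + (2 * ((\<chi> l. axis i 1 $ l * h u $ l) \<bullet> ?g u) +
      (?g u \<bullet> ?g' (axis i 1) + ?g' (axis i 1) \<bullet> ?g u) / (2 * \<alpha>))"
    using partial_eqI[OF deriv] \<phi>(2)[of i] by (simp only: partial_def)
  also have "?g' (axis i 1) \<bullet> ?g u = ?g u \<bullet> ?g' (axis i 1)" by (rule inner_commute)
  also have "?g u \<bullet> ?g' (axis i 1) = \<alpha> * (?g u $ i)\<^sup>2"
    unfolding g_eq by (simp add: axis_def if_distrib[of "\<lambda>x. x * _"] cong: if_cong)
  also have "(\<chi> l. axis i 1 $ l * h u $ l) \<bullet> ?g u = h u $ i * ?g u $ i"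
    by (simp add: axis_scale inner_axis')
  finally show "partial i \<psi> u = (dress_h \<alpha> b u $ i)\<^sup>2"
    using \<alpha> by (simp add: dress_h_def power2_sum)
qed

text \<open>For \<open>i \<noteq> j\<close> both \<open>h\<close> and \<open>g\<close> solve the linear equation \<open>\<partial>\<^sub>j f\<^sub>i = \<beta>\<^sub>i\<^sub>j f\<^sub>j\<close>, hence so does their sum.\<close>

lemma rotation_coefficients_dress_h:
  assumes rot: "\<beta> u = rotation_coefficients h u" and u: "u \<in> U"
    and h0: "\<And>i. h u $ i \<noteq> 0" and hc0: "\<And>i. dress_h \<alpha> b u $ i \<noteq> 0"
  shows "rotation_coefficients (dress_h \<alpha> b) u = \<beta> u"
proof -
  have "partial j (\<lambda>x. dress_h \<alpha> b x $ i) u = \<beta> u $ i $ j * dress_h \<alpha> b u $ j" if "i \<noteq> j" for i j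
  proof -
    have h: "partial j (\<lambda>x. h x $ i) u = \<beta> u $ i $ j * h u $ j"
      unfolding rot using that h0 by (simp add: rotation_coefficients_def)
    have dh: "((\<lambda>x. h x $ i) has_derivative frechet_derivative (\<lambda>x. h x $ i) (at u)) (at u)"
      using smooth_on_bounded_linear[OF open_U bounded_linear_vec_nth smooth_h] u
      by (rule smooth_onD_has_derivative)
    have "partial j (\<lambda>x. dress_h \<alpha> b x $ i) u = partial j (\<lambda>x. h x $ i) u +
        (\<alpha> * axis j 1 $ i * dress_vec \<alpha> b u $ i -
          (\<Sum>k\<in>UNIV. (axis j 1 $ i - axis j 1 $ k) * \<beta> u $ i $ k * dress_vec \<alpha> b u $ k))"
      using partial_eqI[OF has_derivative_add[OF dh bounded_linear.has_derivative[OF bounded_linear_vec_nth[of i]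
              dress_vec_deriv[OF u, of \<alpha> b]]], of j]
      by (simp add: dress_h_def[abs_def] partial_def)
    also have "\<dots> = \<beta> u $ i $ j * h u $ j + \<beta> u $ i $ j * dress_vec \<alpha> b u $ j"
      unfolding h using that
      by (simp add: axis_def if_distrib[of uminus] if_distrib[of "\<lambda>x. x * _"] cong: if_cong)
    finally show ?thesis by (simp add: dress_h_def distrib_left)
  qed
  moreover have "\<beta> u $ i $ i = 0" for i unfolding rot by (simp add: rotation_coefficients_def)
  ultimately show ?thesis
    using hc0 by (simp add: vec_eq_iff rotation_coefficients_def)
qed

end

lemma smooth_rotation_coefficients:
  assumes U: "open U" and h: "smooth_on U h" and h0: "\<And>u i. u \<in> U \<Longrightarrow> h u $ i \<noteq> 0"
  shows "smooth_on U (rotation_coefficients h)"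
proof -
  have "smooth_on U (\<lambda>u. rotation_coefficients h u $ i $ j)" for i j
  proof (cases "i = j")
    case False
    have hi: "smooth_on U (\<lambda>u. h u $ i)" for i
      by (rule smooth_on_bounded_linear[OF U bounded_linear_vec_nth h])
    show ?thesis
      using smooth_on_divide[OF U smooth_on_partial[OF hi[of i]] hi[of j] h0] False
      by (simp add: rotation_coefficients_def)
  qed (simp add: rotation_coefficients_def smooth_on_const)
  then show ?thesis by (simp add: smooth_on_vec_iff[OF U])
qed

text \<open>The second derivatives \<open>\<partial>\<^sub>j\<partial>\<^sub>i\<phi> = 2 h\<^sub>i \<partial>\<^sub>j h\<^sub>i\<close> of the potential are symmetric.\<close>

lemma symmetric_rotation_coefficients:
  assumes U: "open U" and h: "smooth_on U h" and h0: "\<And>u i. u \<in> U \<Longrightarrow> h u $ i \<noteq> 0"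
    and \<phi>: "\<And>u. u \<in> U \<Longrightarrow> \<phi> differentiable (at u)" "\<And>u i. u \<in> U \<Longrightarrow> partial i \<phi> u = (h u $ i)\<^sup>2"
    and u: "u \<in> U"
  shows "transpose (rotation_coefficients h u) = rotation_coefficients h u"
proof -
  have hi: "smooth_on U (\<lambda>u. h u $ i)" for i
    by (rule smooth_on_bounded_linear[OF U bounded_linear_vec_nth h])
  have d\<phi>: "(\<phi> has_derivative (\<lambda>v. \<Sum>i\<in>UNIV. v $ i * (h u $ i * h u $ i))) (at u)" if "u \<in> U" for u
  proof -
    have lin: "linear (frechet_derivative \<phi> (at u))" by (rule linear_frechet_derivative[OF \<phi>(1)[OF that]])
    have "frechet_derivative \<phi> (at u) = (\<lambda>v. \<Sum>i\<in>UNIV. v $ i * (h u $ i * h u $ i))"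
    proof
      fix v
      have "frechet_derivative \<phi> (at u) v = frechet_derivative \<phi> (at u) (\<Sum>i\<in>UNIV. v $ i *\<^sub>R axis i 1)"
        by (simp add: basis_expansion scalar_mult_eq_scaleR[symmetric])
      then show "frechet_derivative \<phi> (at u) v = (\<Sum>i\<in>UNIV. v $ i * (h u $ i * h u $ i))"
        using \<phi>(2)[OF that] by (simp add: linear_sum[OF lin] linear_scale[OF lin] partial_def power2_eq_square)
    qed
    then show ?thesis using frechet_derivative_works[THEN iffD1, OF \<phi>(1)[OF that]] by simp
  qed
  have smooth: "smooth_on U \<phi>"
  proof (rule smooth_on_derivI[OF U])
    show "(\<phi> has_derivative (\<lambda>v. \<Sum>i\<in>UNIV. v $ i * (h u $ i * h u $ i))) (at u)" if "u \<in> U" for u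
      by (rule d\<phi>[OF that])
    show "smooth_on U (\<lambda>u. \<Sum>i\<in>UNIV. v $ i * (h u $ i * h u $ i))" for v
      by (intro smooth_on_sum U smooth_on_bounded_linear[OF U bounded_linear_mult_right]
          smooth_on_bilinear[OF U bounded_bilinear_mult] hi)
  qed
  have "h u $ i * partial j (\<lambda>x. h x $ i) u = h u $ j * partial i (\<lambda>x. h x $ j) u" for i j
  proof -
    have "partial j (partial i \<phi>) u = 2 * (h u $ i * partial j (\<lambda>x. h x $ i) u)" for i j
    proof -
      have "partial j (partial i \<phi>) u = partial j (\<lambda>x. h x $ i * h x $ i) u"
        by (rule partial_cong_open[OF U u]) (simp add: \<phi>(2) power2_eq_square)
      also have "\<dots> = h u $ i * partial j (\<lambda>x. h x $ i) u + partial j (\<lambda>x. h x $ i) u * h u $ i"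
        unfolding partial_def[of j "\<lambda>x. h x $ i"]
        by (rule partial_eqI[OF has_derivative_mult]) (rule smooth_onD_has_derivative[OF hi u])+
      finally show ?thesis by simp
    qed
    moreover have "partial j (partial i \<phi>) u = partial i (partial j \<phi>) u"
      unfolding partial_def by (rule second_derivative_symmetric[OF U u smooth])
    ultimately show ?thesis by simp
  qed
  then have "partial i (\<lambda>x. h x $ j) u / h u $ i = partial j (\<lambda>x. h x $ i) u / h u $ j" for i j
    using h0[OF u] by (simp add: frac_eq_eq mult.commute)
  then show ?thesis
    by (simp add: vec_eq_iff transpose_def rotation_coefficients_def)
qed

theorem theorem5p5:
  fixes \<Omega> :: "(real^'n) set" and h :: "real^'n \<Rightarrow> real^'n"
    and E :: "real^'n \<Rightarrow> complex \<Rightarrow> complex^'n^'n" and X :: "real^'n \<Rightarrow> complex \<Rightarrow> complex^'n"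
    and \<alpha> :: real and b :: "real^'n"
  assumes "open \<Omega>" and "connected \<Omega>" and "simply_connected \<Omega>" and "0 \<in> \<Omega>"
    and "flat_egoroff_on \<Omega> h"
    and "extended_frame_on \<Omega> h (\<lambda>u z. affine_block (E u z) (X u z) 1)"
    and "flat_lagrangian_family_on \<Omega> h X"
    and "\<alpha> \<noteq> 0"
  shows "\<exists>Ec Xc hc \<beta>c.
    dressing_on \<Omega> (simple_element (\<i> * \<alpha>) b) (\<lambda>u z. affine_block (E u z) (X u z) 1)
      (\<lambda>u z. affine_block (Ec u z) (Xc u z) 1) \<and>
    (\<forall>G. dressing_on \<Omega> (simple_element (\<i> * \<alpha>) b) (\<lambda>u z. affine_block (E u z) (X u z) 1) G \<longrightarrow>
      (\<forall>u\<in>\<Omega>. \<forall>z. G u z = affine_block (Ec u z) (Xc u z) 1)) \<and>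
    (\<forall>z. affine_block (Ec 0 z) (Xc 0 z) 1 = mat 1) \<and>
    frame_equation_on \<Omega> \<beta>c hc (\<lambda>u z. affine_block (Ec u z) (Xc u z) 1) \<and>
    (\<forall>u\<in>\<Omega>. \<forall>z. z \<noteq> \<i> * \<alpha> \<longrightarrow>
      Xc u z = X u z + (\<i> / (z - \<i> * \<alpha>)) *s
        (complex_vec b - E u z *v (matrix_inv (E u (\<i> * \<alpha>)) *v complex_vec b))) \<and>
    (\<forall>u\<in>\<Omega>. complex_vec (hc u) = complex_vec (h u) + matrix_inv (E u (\<i> * \<alpha>)) *v complex_vec b) \<and>
    (\<forall>U. open U \<and> U \<subseteq> \<Omega> \<and> (\<forall>u\<in>U. \<forall>i. hc u $ i \<noteq> 0) \<longrightarrow>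
      flat_egoroff_on U hc \<and>
      frame_equation_on U (rotation_coefficients hc) hc (\<lambda>u z. affine_block (Ec u z) (Xc u z) 1) \<and>
      flat_lagrangian_family_on U hc Xc)"
proof -
  let ?\<beta> = "rotation_coefficients h"
  have h: "smooth_on \<Omega> h" and h0: "\<And>u i. u \<in> \<Omega> \<Longrightarrow> h u $ i \<noteq> 0"
    using assms(5) unfolding flat_egoroff_on_def by blast+
  obtain \<phi> :: "real^'n \<Rightarrow> real" where \<phi>: "\<And>u. u \<in> \<Omega> \<Longrightarrow> \<phi> differentiable (at u)"
    "\<And>u i. u \<in> \<Omega> \<Longrightarrow> partial i \<phi> u = (h u $ i)\<^sup>2"
    using assms(5) unfolding flat_egoroff_on_def by blast
  have frame: "frame_equation_on \<Omega> ?\<beta> h (\<lambda>u z. affine_block (E u z) (X u z) 1)"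
    and initial: "E 0 z = mat 1" "X 0 z = 0" for z
    using assms(6) unfolding extended_frame_on_def affine_block_one[symmetric] affine_block_inject by blast+
  have ef: "egoroff_frame \<Omega> ?\<beta> h E X"
    by (rule egoroff_frameI[OF assms(1,2,4) smooth_rotation_coefficients[OF assms(1) h h0]
          symmetric_rotation_coefficients[OF assms(1) h h0 \<phi>] h frame initial(1)])
  interpret egoroff_frame \<Omega> ?\<beta> h E X by (rule ef)
  interpret dressed: egoroff_frame \<Omega> ?\<beta> "dress_h \<alpha> b" E "dress_X \<alpha> b"
    by (rule egoroff_frame_dressed)
  have geometry: "\<forall>U. open U \<and> U \<subseteq> \<Omega> \<and> (\<forall>u\<in>U. \<forall>i. dress_h \<alpha> b u $ i \<noteq> 0) \<longrightarrow>
      flat_egoroff_on U (dress_h \<alpha> b) \<and>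
      frame_equation_on U (rotation_coefficients (dress_h \<alpha> b)) (dress_h \<alpha> b)
        (\<lambda>u z. affine_block (E u z) (dress_X \<alpha> b u z) 1) \<and>
      flat_lagrangian_family_on U (dress_h \<alpha> b) (dress_X \<alpha> b)"
  proof (intro allI impI conjI)
    fix V assume "open V \<and> V \<subseteq> \<Omega> \<and> (\<forall>u\<in>V. \<forall>i. dress_h \<alpha> b u $ i \<noteq> 0)"
    then have V: "open V" "V \<subseteq> \<Omega>" and hc0: "\<And>u i. u \<in> V \<Longrightarrow> dress_h \<alpha> b u $ i \<noteq> 0" by blast+
    have V\<Omega>: "u \<in> \<Omega>" if "u \<in> V" for u using that V(2) by blast
    define \<psi> where "\<psi> x = \<phi> x + (2 * (b \<bullet> (\<chi> i. Re (X x (- (\<i> * \<alpha>)) $ i))) +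
      (dress_vec \<alpha> b x \<bullet> dress_vec \<alpha> b x) / (2 * \<alpha>))" for x
    have "\<psi> differentiable (at u)" "partial i \<psi> u = (dress_h \<alpha> b u $ i)\<^sup>2" if "u \<in> V" for u i
      unfolding \<psi>_def[abs_def]
      by (rule dressed_potential[OF ef \<phi>(1)[OF V\<Omega>[OF that]] \<phi>(2)[OF V\<Omega>[OF that]] V\<Omega>[OF that] assms(8)])+
    then have "\<exists>\<psi>::real^'n \<Rightarrow> real. \<forall>u\<in>V. \<psi> differentiable (at u) \<and> (\<forall>i. partial i \<psi> u = (dress_h \<alpha> b u $ i)\<^sup>2)"
      by blast
    then show "flat_egoroff_on V (dress_h \<alpha> b)"
      unfolding flat_egoroff_on_def
      using hc0 smooth_on_subset[OF smooth_dress_h V(2)] dressed.flat_diagonal_metric[OF V hc0] by blast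
    show "frame_equation_on V (rotation_coefficients (dress_h \<alpha> b)) (dress_h \<alpha> b)
        (\<lambda>u z. affine_block (E u z) (dress_X \<alpha> b u z) 1)"
    proof (rule frame_equation_on_cong[OF dressed.frame_equation V(2)])
      fix u assume u: "u \<in> V"
      show "?\<beta> u = rotation_coefficients (dress_h \<alpha> b) u"
        by (rule rotation_coefficients_dress_h[OF ef refl V\<Omega>[OF u] h0[OF V\<Omega>[OF u]] hc0[OF u], symmetric])
    qed
    show "flat_lagrangian_family_on V (dress_h \<alpha> b) (dress_X \<alpha> b)"
      by (rule dressed.flat_lagrangian_family_X[OF V hc0])
  qed
  have hc: "\<forall>u\<in>\<Omega>. complex_vec (dress_h \<alpha> b u) = complex_vec (h u) + matrix_inv (E u (\<i> * \<alpha>)) *v complex_vec b"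
    by (simp add: complex_vec_dress_vec[symmetric] dress_h_def vec_eq_iff)
  have Xc: "\<forall>u\<in>\<Omega>. \<forall>z. z \<noteq> \<i> * \<alpha> \<longrightarrow> dress_X \<alpha> b u z = X u z + (\<i> / (z - \<i> * \<alpha>)) *s
      (complex_vec b - E u z *v (matrix_inv (E u (\<i> * \<alpha>)) *v complex_vec b))"
    using dress_X_off_pole[of _ _ \<alpha> b] by (simp add: dress_residue_def complex_vec_dress_vec)
  have unique: "\<forall>G. dressing_on \<Omega> (simple_element (\<i> * \<alpha>) b) (\<lambda>u z. affine_block (E u z) (X u z) 1) G \<longrightarrow>
      (\<forall>u\<in>\<Omega>. \<forall>z. G u z = affine_block (E u z) (dress_X \<alpha> b u z) 1)"
    using dressing_on_simple_element_unique[OF ef] by blast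
  have initial': "\<forall>z. affine_block (E 0 z) (dress_X \<alpha> b 0 z) 1 = mat 1"
    using dressed_initial[OF ef assms(4) initial] by blast
  show ?thesis
    by (rule exI[of _ E], rule exI[of _ "dress_X \<alpha> b"], rule exI[of _ "dress_h \<alpha> b"], rule exI[of _ ?\<beta>],
        intro conjI)
      (fact dressing_on_simple_element[OF ef] unique initial' dressed.frame_equation Xc hc geometry)+
qed

end
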